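(* There exists a pseudopolynomial transformation of the standard (non-malleable) problem of makespan minimization on unrelated machines to the problem of malleable scheduling with speed-implementable processing times (scheduling malleable jobs on unrelated machines with the makespan objective).
   Context: Standard makespan minimization on unrelated machines: given finite sets $\mathcal{M}$ of machines and $\mathcal{J}$ of jobs and processing times $p_{i,j} \in \mathbb{Z}_+$, assign each job to exactly one machine so as to minimize $\max_{i\in\mathcal{M}} \sum_{j \text{ assigned to } i} p_{i,j}$. Malleable scheduling with speed-implementable processing times: an instance consists of a finite set $\mathcal{J}$ of jobs, a finite set $\mathcal{M}$ of machines, a non-negative speed $s_{i,j}$ for each $i \in \mathcal{M}$, $j \in \mathcal{J}$ (integral, or rational, up to scaling), and for each job $j$ a processing time function $f_j$ defined on $\mathbb{R}_+$ with $f_j(0)=+\infty$, $f_j(s)\in\mathbb{R}_+$ for $s>0$, $f_j(s)$ non-increasing in $s$, and $s\cdot f_j(s)$ non-decreasing in $s>0$. For $S \subseteq \mathcal{M}$ let $\sigma_j(S) = \sum_{i \in S} s_{i,j}$ and $f_j(S) := f_j(\sigma_j(S))$. A feasible schedule chooses for each job $j$ a set $S_j \subseteq \mathcal{M}$ and a start time $\tau_j \ge 0$; job $j$ occupies all machines of $S_j$ (non-preemptively and in unison) during $[\tau_j, \tau_j + f_j(S_j)]$, and each machine processes at most one job at a time. The makespan is $\max_{j} (\tau_j + f_j(S_j))$, to be minimized. A pseudopolynomial transformation of one optimization problem to another is a map, computable in time polynomial in the input size when numbers are encoded in unary, sending each instance of the first problem to an instance of the second, such that from any optimal solution of the resulting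 instance one can efficiently obtain an optimal solution of the original instance. *)

theory Defs
  imports "HOL-Library.Extended_Real" "HOL-Computational_Algebra.Polynomial"
begin

section \<open>Model of computation\<close>

text \<open>
  Time is measured on the WHILE language over binary trees (N. D. Jones, Computability and
  Complexity from a Programming Perspective). Every evaluation of an expression is
  charged the total size of all values it produces, i.e. values are copied and never shared; hence
  time bounds are polynomially related to those of Turing machines, also for programs with large
  outputs.
\<close>

datatype tree = Leaf | Node tree tree

datatype exp = VarE nat | NilE | ConsE exp exp | HdE exp | TlE exp

datatype com =
    Skip
  | Assign nat exp
  | Seq com com
  | IfC exp com com
  | WhileC exp com

type_synonym state = "nat \<Rightarrow> tree"

fun hd_tree :: "tree \<Rightarrow> tree" where
  "hd_tree Leaf = Leaf"
| "hd_tree (Node l r) = l"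

fun tl_tree :: "tree \<Rightarrow> tree" where
  "tl_tree Leaf = Leaf"
| "tl_tree (Node l r) = r"

fun eval_exp :: "exp \<Rightarrow> state \<Rightarrow> tree" where
  "eval_exp (VarE x) s = s x"
| "eval_exp NilE s = Leaf"
| "eval_exp (ConsE a b) s = Node (eval_exp a s) (eval_exp b s)"
| "eval_exp (HdE a) s = hd_tree (eval_exp a s)"
| "eval_exp (TlE a) s = tl_tree (eval_exp a s)"

fun exp_time :: "exp \<Rightarrow> state \<Rightarrow> nat" where
  "exp_time (VarE x) s = 1 + size (s x)"
| "exp_time NilE s = 1"
| "exp_time (ConsE a b) s = exp_time a s + exp_time b s + 1 + size (eval_exp (ConsE a b) s)"
| "exp_time (HdE a) s = exp_time a s + 1 + size (eval_exp (HdE a) s)"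
| "exp_time (TlE a) s = exp_time a s + 1 + size (eval_exp (TlE a) s)"

text \<open>\<open>exec c s t s'\<close>: started in \<open>s\<close>, the command \<open>c\<close> terminates in \<open>s'\<close> after time \<open>t\<close>.
  A test succeeds iff its value is not \<open>Leaf\<close>.\<close>

inductive exec :: "com \<Rightarrow> state \<Rightarrow> nat \<Rightarrow> state \<Rightarrow> bool" where
  Skip: "exec Skip s 1 s"
| Assign: "exec (Assign x e) s (1 + exp_time e s) (s(x := eval_exp e s))"
| Seq: "exec c1 s t1 s' \<Longrightarrow> exec c2 s' t2 s'' \<Longrightarrow> exec (Seq c1 c2) s (1 + t1 + t2) s''"
| IfTrue: "eval_exp e s \<noteq> Leaf \<Longrightarrow> exec c1 s t s' \<Longrightarrow>
    exec (IfC e c1 c2) s (1 + exp_time e s + t) s'"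
| IfFalse: "eval_exp e s = Leaf \<Longrightarrow> exec c2 s t s' \<Longrightarrow>
    exec (IfC e c1 c2) s (1 + exp_time e s + t) s'"
| WhileFalse: "eval_exp e s = Leaf \<Longrightarrow> exec (WhileC e c) s (1 + exp_time e s) s"
| WhileTrue: "eval_exp e s \<noteq> Leaf \<Longrightarrow> exec c s t1 s' \<Longrightarrow> exec (WhileC e c) s' t2 s'' \<Longrightarrow>
    exec (WhileC e c) s (1 + exp_time e s + t1 + t2) s''"

definition computes_in :: "com \<Rightarrow> tree \<Rightarrow> tree \<Rightarrow> nat \<Rightarrow> bool" where
  "computes_in c d d' t \<longleftrightarrow> (\<exists>s. exec c ((\<lambda>_. Leaf)(0 := d)) t s \<and> s 0 = d')"


section \<open>Encodings\<close>

definition list_tree :: "tree list \<Rightarrow> tree" where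
  "list_tree ts = foldr Node ts Leaf"

definition bool_tree :: "bool \<Rightarrow> tree" where
  "bool_tree b = (if b then Node Leaf Leaf else Leaf)"

definition unary :: "nat \<Rightarrow> tree" where
  "unary n = list_tree (replicate n Leaf)"

text \<open>Least significant bit first.\<close>

fun binary :: "nat \<Rightarrow> tree" where
  "binary n = (if n = 0 then Leaf else Node (bool_tree (odd n)) (binary (n div 2)))"

declare binary.simps [simp del]

text \<open>Only used for non-negative rationals, which are represented in lowest terms. The parameter
  \<open>num\<close>, here and below, is the encoding of natural numbers (\<open>unary\<close> or \<open>binary\<close>).\<close>

definition rat_tree :: "(nat \<Rightarrow> tree) \<Rightarrow> rat \<Rightarrow> tree" where
  "rat_tree num r = (case quotient_of r of (a, b) \<Rightarrow> Node (num (nat a)) (num (nat b)))"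


section \<open>Optimization problems and pseudopolynomial transformations\<close>

record ('i, 's, 'v) opt_problem =
  insts :: "'i set"
  feasible :: "'i \<Rightarrow> 's \<Rightarrow> bool"
  objective :: "'i \<Rightarrow> 's \<Rightarrow> 'v"
  inst_code :: "(nat \<Rightarrow> tree) \<Rightarrow> 'i \<Rightarrow> tree \<Rightarrow> bool"
  sol_code :: "(nat \<Rightarrow> tree) \<Rightarrow> 'i \<Rightarrow> 's \<Rightarrow> tree \<Rightarrow> bool"

definition optimal :: "('i, 's, 'v::linorder) opt_problem \<Rightarrow> 'i \<Rightarrow> 's \<Rightarrow> bool" where
  "optimal P x y \<longleftrightarrow> feasible P x y \<and>
     (\<forall>y'. feasible P x y' \<longrightarrow> objective P x y \<le> objective P x y')"

text \<open>
  Numbers of the source problem are encoded in unary, those of the target problem in binary.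
  The second algorithm receives the original instance together with an optimal
  solution of the transformed instance.
\<close>

definition pseudopoly_transformation ::
  "('i, 's, 'v::linorder) opt_problem \<Rightarrow> ('k, 'r, 'w::linorder) opt_problem \<Rightarrow> ('i \<Rightarrow> 'k) \<Rightarrow> bool"
where
  "pseudopoly_transformation P Q F \<longleftrightarrow>
     (\<forall>x \<in> insts P. F x \<in> insts Q) \<and>
     (\<exists>c (q :: nat poly). \<forall>x \<in> insts P. \<forall>d. inst_code P unary x d \<longrightarrow>
        (\<exists>d' t. computes_in c d d' t \<and> t \<le> poly q (size d) \<and> inst_code Q binary (F x) d')) \<and>
     (\<exists>c (q :: nat poly). \<forall>x \<in> insts P. \<forall>y d e.
        inst_code P unary x d \<longrightarrow> optimal Q (F x) y \<longrightarrow> sol_code Q binary (F x) y e \<longrightarrow>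
        (\<exists>z d' t. computes_in c (Node d e) d' t \<and> t \<le> poly q (size (Node d e)) \<and>
           sol_code P unary x z d' \<and> optimal P x z))"


section \<open>Makespan minimization on unrelated machines\<close>

text \<open>In both problems the machines are \<open>{..<m}\<close> and the jobs are \<open>{..<n}\<close>.\<close>

record unrelated_inst =
  um_m :: nat
  um_n :: nat
  um_p :: "nat \<Rightarrow> nat \<Rightarrow> nat"  \<comment> \<open>machine, job\<close>

text \<open>A solution maps each job to its machine.\<close>

definition um_feasible :: "unrelated_inst \<Rightarrow> (nat \<Rightarrow> nat) \<Rightarrow> bool" where
  "um_feasible x a \<longleftrightarrow> (\<forall>j < um_n x. a j < um_m x)"

definition um_makespan :: "unrelated_inst \<Rightarrow> (nat \<Rightarrow> nat) \<Rightarrow> nat" where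
  "um_makespan x a = Max ((\<lambda>i. \<Sum>j | j < um_n x \<and> a j = i. um_p x i j) ` {..<um_m x})"

definition um_inst_code :: "(nat \<Rightarrow> tree) \<Rightarrow> unrelated_inst \<Rightarrow> tree \<Rightarrow> bool" where
  "um_inst_code num x d \<longleftrightarrow> d = list_tree
     [num (um_m x), num (um_n x),
      list_tree (map (\<lambda>i. list_tree (map (\<lambda>j. num (um_p x i j)) [0..<um_n x])) [0..<um_m x])]"

definition um_sol_code ::
  "(nat \<Rightarrow> tree) \<Rightarrow> unrelated_inst \<Rightarrow> (nat \<Rightarrow> nat) \<Rightarrow> tree \<Rightarrow> bool" where
  "um_sol_code num x a d \<longleftrightarrow> d = list_tree (map (\<lambda>j. num (a j)) [0..<um_n x])"

text \<open>At least one machine is needed for the makespan, a maximum over machines, to be defined.\<close>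

definition unrelated_scheduling :: "(unrelated_inst, nat \<Rightarrow> nat, nat) opt_problem" where
  "unrelated_scheduling =
     \<lparr>insts = {x. um_m x > 0}, feasible = um_feasible, objective = um_makespan,
      inst_code = um_inst_code, sol_code = um_sol_code\<rparr>"


section \<open>Malleable scheduling with speed-implementable processing times\<close>

record malleable_inst =
  ml_m :: nat
  ml_n :: nat
  ml_s :: "nat \<Rightarrow> nat \<Rightarrow> rat"  \<comment> \<open>machine, job\<close>
  ml_f :: "nat \<Rightarrow> real \<Rightarrow> ereal"  \<comment> \<open>job; only arguments \<open>s \<ge> 0\<close> matter\<close>

definition processing_time_function :: "(real \<Rightarrow> ereal) \<Rightarrow> bool" where
  "processing_time_function f \<longleftrightarrow>
     f 0 = \<infinity> \<and>
     (\<forall>s > 0. 0 \<le> f s \<and> f s < \<infinity>) \<and>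
     (\<forall>s s'. 0 \<le> s \<longrightarrow> s \<le> s' \<longrightarrow> f s' \<le> f s) \<and>
     (\<forall>s s'. 0 < s \<longrightarrow> s \<le> s' \<longrightarrow> ereal s * f s \<le> ereal s' * f s')"

definition ml_valid :: "malleable_inst \<Rightarrow> bool" where
  "ml_valid x \<longleftrightarrow>
     (\<forall>i < ml_m x. \<forall>j < ml_n x. 0 \<le> ml_s x i j) \<and>
     (\<forall>j < ml_n x. processing_time_function (ml_f x j))"

definition ml_sigma :: "malleable_inst \<Rightarrow> nat \<Rightarrow> nat set \<Rightarrow> rat" where
  "ml_sigma x j S = (\<Sum>i\<in>S. ml_s x i j)"

definition ml_time :: "malleable_inst \<Rightarrow> nat \<Rightarrow> nat set \<Rightarrow> ereal" where
  "ml_time x j S = ml_f x j (real_of_rat (ml_sigma x j S))"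

text \<open>A schedule is a pair of the machine sets \<open>S\<close> and the start times \<open>\<tau>\<close> of the jobs.\<close>

type_synonym schedule = "(nat \<Rightarrow> nat set) \<times> (nat \<Rightarrow> real)"

definition ml_completion :: "malleable_inst \<Rightarrow> schedule \<Rightarrow> nat \<Rightarrow> ereal" where
  "ml_completion x y j = (case y of (S, \<tau>) \<Rightarrow> ereal (\<tau> j) + ml_time x j (S j))"

text \<open>Jobs sharing a machine may meet at an endpoint of their processing intervals. As in the
  definition of a schedule, \<open>S j\<close> may have total speed 0, in which case the makespan is infinite;
  so every valid instance has feasible schedules, and possibly only ones of makespan \<open>\<infinity>\<close>.\<close>

definition ml_feasible :: "malleable_inst \<Rightarrow> schedule \<Rightarrow> bool" where
  "ml_feasible x y \<longleftrightarrow> (case y of (S, \<tau>) \<Rightarrow>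
     (\<forall>j < ml_n x. S j \<subseteq> {..<ml_m x} \<and> 0 \<le> \<tau> j) \<and>
     (\<forall>j < ml_n x. \<forall>k < ml_n x. j \<noteq> k \<longrightarrow> S j \<inter> S k \<noteq> {} \<longrightarrow>
        ml_completion x y j \<le> ereal (\<tau> k) \<or> ml_completion x y k \<le> ereal (\<tau> j)))"

text \<open>Completion times are non-negative, so inserting 0 only sets the makespan for an empty set of
  jobs.\<close>

definition ml_makespan :: "malleable_inst \<Rightarrow> schedule \<Rightarrow> ereal" where
  "ml_makespan x y = Max (insert 0 (ml_completion x y ` {..<ml_n x}))"

text \<open>
  To be part of an input, a processing time function needs a finite description: a list of
  rational points \<open>(s, f s)\<close> with increasing \<open>s\<close>, between which the function is linear; before the
  first and after the last point it is constant. Instances whose functions are not of this form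
  have no code.
\<close>

fun interpolate :: "(rat \<times> rat) list \<Rightarrow> real \<Rightarrow> real" where
  "interpolate [] s = 0"
| "interpolate [(a, b)] s = real_of_rat b"
| "interpolate ((a, b) # (a', b') # ps) s =
     (if s \<le> real_of_rat a then real_of_rat b
      else if s \<le> real_of_rat a' then
        real_of_rat b + real_of_rat ((b' - b) / (a' - a)) * (s - real_of_rat a)
      else interpolate ((a', b') # ps) s)"

definition describes :: "(rat \<times> rat) list \<Rightarrow> (real \<Rightarrow> ereal) \<Rightarrow> bool" where
  "describes ps f \<longleftrightarrow>
     ps \<noteq> [] \<and> sorted_wrt (<) (map fst ps) \<and> (\<forall>(a, b) \<in> set ps. 0 < a \<and> 0 \<le> b) \<and>
     f 0 = \<infinity> \<and> (\<forall>s > 0. f s = ereal (interpolate ps s))"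

definition ml_inst_code :: "(nat \<Rightarrow> tree) \<Rightarrow> malleable_inst \<Rightarrow> tree \<Rightarrow> bool" where
  "ml_inst_code num x d \<longleftrightarrow> (\<exists>ps. (\<forall>j < ml_n x. describes (ps j) (ml_f x j)) \<and>
     d = list_tree
       [num (ml_m x), num (ml_n x),
        list_tree (map (\<lambda>i. list_tree (map (\<lambda>j. rat_tree num (ml_s x i j)) [0..<ml_n x]))
          [0..<ml_m x]),
        list_tree (map (\<lambda>j. list_tree
          (map (\<lambda>(a, b). Node (rat_tree num a) (rat_tree num b)) (ps j))) [0..<ml_n x])])"

text \<open>
  Each \<open>S j\<close> is given by its incidence vector. Only schedules with rational start times have
  a code, but optimality ranges over all real ones. As speeds and processing times of an encoded
  instance are rational, each finite-makespan schedule can be shifted to rational start times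
  without increasing its makespan.
\<close>

definition ml_sol_code ::
  "(nat \<Rightarrow> tree) \<Rightarrow> malleable_inst \<Rightarrow> schedule \<Rightarrow> tree \<Rightarrow> bool" where
  "ml_sol_code num x y d \<longleftrightarrow> (case y of (S, \<tau>) \<Rightarrow>
     (\<exists>r. (\<forall>j < ml_n x. \<tau> j = real_of_rat (r j)) \<and>
        d = list_tree (map (\<lambda>j. Node
          (list_tree (map (\<lambda>i. bool_tree (i \<in> S j)) [0..<ml_m x]))
          (rat_tree num (r j))) [0..<ml_n x])))"

definition malleable_scheduling :: "(malleable_inst, schedule, ereal) opt_problem" where
  "malleable_scheduling =
     \<lparr>insts = {x. ml_valid x}, feasible = ml_feasible, objective = ml_makespan,
      inst_code = ml_inst_code, sol_code = ml_sol_code\<rparr>"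

end

theory Submission
  imports Defs
begin

text \<open>
  All jobs get the same processing time function, which takes the value \<open>e + 1\<close> at
  \<open>1 / 2 ^ e\<close> and is linear in between. Machine \<open>i\<close> processes job \<open>j\<close> with speed
  \<open>1 / 2 ^ e\<close> for \<open>e = N * p i j + m + 1\<close>, so alone it needs time \<open>N * p i j + m + 2\<close>.
  A set of machines is at most \<open>m \<le> 2 ^ m\<close> times as fast as its fastest member, and hence saves at
  most time \<open>m\<close>, which leaves at least \<open>N * p i j\<close>. If each job is moved to the fastest machine of
  its set, the makespan of the original problem, scaled by \<open>N\<close>, therefore does not exceed the one
  of the schedule. Conversely, an assignment costs at most \<open>n * (m + 2)\<close> more as a schedule, and
  this is less than \<open>N\<close>.

  Speeds being powers of two, their binary codes are unary codes of the exponents up to a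
  constant suffix. Both algorithms are obtained from a class of polynomial-time functions on trees
  that is closed under structural recursion along lists with bounded growth.
\<close>

section \<open>Polynomial-time functions on trees\<close>

definition poly_bounded :: "(nat \<Rightarrow> nat) \<Rightarrow> bool" where
  "poly_bounded g \<longleftrightarrow> (\<exists>q. \<forall>n. g n \<le> poly q n)"

lemma poly_bounded_const: "poly_bounded (\<lambda>n. c)"
  unfolding poly_bounded_def by (rule exI[of _ "[:c:]"]) simp

lemma poly_bounded_ident: "poly_bounded (\<lambda>n. n)"
  unfolding poly_bounded_def by (rule exI[of _ "[:0, 1:]"]) simp

lemma poly_bounded_add:
  assumes "poly_bounded f" "poly_bounded g"
  shows "poly_bounded (\<lambda>n. f n + g n)"
proof -
  obtain p q where "\<And>n. f n \<le> poly p n" "\<And>n. g n \<le> poly q n"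
    using assms unfolding poly_bounded_def by blast
  then have "\<forall>n. f n + g n \<le> poly (p + q) n" by (simp add: add_mono)
  then show ?thesis unfolding poly_bounded_def by blast
qed

lemma poly_bounded_mult:
  assumes "poly_bounded f" "poly_bounded g"
  shows "poly_bounded (\<lambda>n. f n * g n)"
proof -
  obtain p q where "\<And>n. f n \<le> poly p n" "\<And>n. g n \<le> poly q n"
    using assms unfolding poly_bounded_def by blast
  then have "\<forall>n. f n * g n \<le> poly (p * q) n" by (simp add: mult_mono)
  then show ?thesis unfolding poly_bounded_def by blast
qed

lemma poly_nat_mono: "m \<le> n \<Longrightarrow> poly q m \<le> poly q n" for q :: "nat poly"
  by (induction q) (auto intro: add_mono mult_mono)

lemma poly_bounded_poly:
  assumes "poly_bounded g"
  shows "poly_bounded (\<lambda>n. poly p (g n))"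
proof -
  obtain q where "\<And>n. g n \<le> poly q n"
    using assms unfolding poly_bounded_def by blast
  then have "\<forall>n. poly p (g n) \<le> poly (pcompose p q) n"
    by (simp add: poly_pcompose poly_nat_mono)
  then show ?thesis unfolding poly_bounded_def by blast
qed

lemmas poly_bounded_intros =
  poly_bounded_const poly_bounded_ident poly_bounded_add poly_bounded_mult poly_bounded_poly

section \<open>Execution within a time bound\<close>

text \<open>Upper bounds in place of exact times: runs of different cost can share one bound, and
  bounds can be coarsened at any point.\<close>

definition exec_le :: "com \<Rightarrow> state \<Rightarrow> nat \<Rightarrow> state \<Rightarrow> bool" where
  "exec_le c s T s' \<longleftrightarrow> (\<exists>t\<le>T. exec c s t s')"

lemma exec_le_mono: "exec_le c s T s' \<Longrightarrow> T \<le> T' \<Longrightarrow> exec_le c s T' s'"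
  unfolding exec_le_def using le_trans by blast

lemma exec_le_Assign: "s' = s(x := eval_exp e s) \<Longrightarrow> exec_le (Assign x e) s (1 + exp_time e s) s'"
  unfolding exec_le_def using exec.Assign by blast

lemma exec_le_Seq:
  assumes "exec_le c1 s T1 s'" "exec_le c2 s' T2 s''"
  shows "exec_le (Seq c1 c2) s (1 + T1 + T2) s''"
  using assms unfolding exec_le_def by (meson add_mono exec.Seq le_refl)

text \<open>Both branch bounds are added, not maximised, so that polynomial bounds remain
  polynomials.\<close>

lemma exec_le_If:
  assumes "eval_exp e s \<noteq> Leaf \<Longrightarrow> exec_le c1 s T1 s'"
    and "eval_exp e s = Leaf \<Longrightarrow> exec_le c2 s T2 s'"
  shows "exec_le (IfC e c1 c2) s (1 + exp_time e s + T1 + T2) s'"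
proof (cases "eval_exp e s = Leaf")
  case True
  then obtain t where "t \<le> T2" "exec c2 s t s'" using assms unfolding exec_le_def by blast
  then show ?thesis using exec.IfFalse[OF True, of c2 t s' c1] unfolding exec_le_def
    by (intro exI[of _ "1 + exp_time e s + t"]) auto
next
  case False
  then obtain t where "t \<le> T1" "exec c1 s t s'" using assms unfolding exec_le_def by blast
  then show ?thesis using exec.IfTrue[OF False, of c1 t s' c2] unfolding exec_le_def
    by (intro exI[of _ "1 + exp_time e s + t"]) auto
qed

lemma exec_le_WhileFalse:
  "eval_exp e s = Leaf \<Longrightarrow> exec_le (WhileC e c) s (1 + exp_time e s) s"
  unfolding exec_le_def using exec.WhileFalse by blast

lemma exec_le_WhileTrue:
  assumes "eval_exp e s \<noteq> Leaf" "exec_le c s T1 s'" "exec_le (WhileC e c) s' T2 s''"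
  shows "exec_le (WhileC e c) s (1 + exp_time e s + T1 + T2) s''"
  using assms unfolding exec_le_def by (meson add_mono exec.WhileTrue le_refl)

lemma size_eval_exp: "size (eval_exp e s) \<le> exp_time e s"
  by (induction e) auto

text \<open>An assignment is charged at least the size of the value that it writes, by
  \<open>size_eval_exp\<close>. Time bounds therefore yield size bounds.\<close>

lemma exec_size: "exec c s t s' \<Longrightarrow> size (s' x) \<le> size (s x) + t"
proof (induction rule: exec.induct)
  case (Assign y e s)
  then show ?case using size_eval_exp[of e s] by auto
qed auto

text \<open>Programs address their variables relative to a stack: \<open>a ## s\<close> pushes a variable, and
  \<open>lift c\<close> runs \<open>c\<close> below it.\<close>

definition push :: "tree \<Rightarrow> state \<Rightarrow> state" (infixr "##" 65) where
  "a ## s = case_nat a s"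

lemma push_apply [simp]: "(a ## s) 0 = a" "(a ## s) (Suc n) = s n"
  by (simp_all add: push_def)

definition empty :: state where "empty = (\<lambda>_. Leaf)"

lemma empty_apply: "empty x = Leaf"
  by (simp add: empty_def)

text \<open>As rewrite rules these normalise every state of a program to a finite stack on
  \<open>empty\<close>; the last rule removes variables that have been reset.\<close>

lemma push_update [simp]:
  "(a ## s)(0 := b) = b ## s"
  "(a ## s)(Suc n := b) = a ## s(n := b)"
  "empty(0 := b) = b ## empty"
  "empty(Suc n := b) = Leaf ## empty(n := b)"
  "Leaf ## empty = empty"
  by (auto simp: fun_eq_iff empty_def push_def split: nat.splits)

fun lift_exp :: "exp \<Rightarrow> exp" where
  "lift_exp (VarE x) = VarE (Suc x)"
| "lift_exp NilE = NilE"
| "lift_exp (ConsE a b) = ConsE (lift_exp a) (lift_exp b)"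
| "lift_exp (HdE a) = HdE (lift_exp a)"
| "lift_exp (TlE a) = TlE (lift_exp a)"

fun lift :: "com \<Rightarrow> com" where
  "lift Skip = Skip"
| "lift (Assign x e) = Assign (Suc x) (lift_exp e)"
| "lift (Seq a b) = Seq (lift a) (lift b)"
| "lift (IfC e a b) = IfC (lift_exp e) (lift a) (lift b)"
| "lift (WhileC e a) = WhileC (lift_exp e) (lift a)"

lemma eval_lift_exp [simp]: "eval_exp (lift_exp e) (a ## s) = eval_exp e s"
  by (induction e) auto

lemma time_lift_exp [simp]: "exp_time (lift_exp e) (a ## s) = exp_time e s"
  by (induction e) auto

lemma exec_lift: "exec c s t s' \<Longrightarrow> exec (lift c) (a ## s) t (a ## s')"
proof (induction rule: exec.induct)
  case (Skip s)
  then show ?case using exec.Skip by simp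
next
  case (Assign x e s)
  then show ?case using exec.Assign[of "Suc x" "lift_exp e" "a ## s"]
    by (simp del: fun_upd_apply)
next
  case (IfTrue e s c1 t s' c2)
  then show ?case using exec.IfTrue[of "lift_exp e" "a ## s" "lift c1" t "a ## s'" "lift c2"] by simp
next
  case (IfFalse e s c2 t s' c1)
  then show ?case using exec.IfFalse[of "lift_exp e" "a ## s" "lift c2" t "a ## s'" "lift c1"] by simp
next
  case (WhileFalse e s c)
  then show ?case using exec.WhileFalse[of "lift_exp e" "a ## s" "lift c"] by simp
next
  case (Seq c1 s t1 s' c2 t2 s'')
  then show ?case
    using exec.Seq[of "lift c1" "a ## s" t1 "a ## s'" "lift c2" t2 "a ## s''"] by simp
next
  case (WhileTrue e s c t1 s' t2 s'')
  then show ?case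
    using exec.WhileTrue[of "lift_exp e" "a ## s" "lift c" t1 "a ## s'" t2 "a ## s''"] by simp
qed

lemma exec_le_lift: "exec_le c s T s' \<Longrightarrow> exec_le (lift c) (a ## s) T (a ## s')"
  unfolding exec_le_def using exec_lift by blast

text \<open>Variables other than the output are reset at the end, so that programs can be composed by
  \<open>Seq\<close>.\<close>

definition ptime :: "(tree \<Rightarrow> tree) \<Rightarrow> bool" where
  "ptime f \<longleftrightarrow> (\<exists>c q. \<forall>d. exec_le c (d ## empty) (poly q (size d)) (f d ## empty))"

lemma ptimeI:
  assumes "poly_bounded g" "\<And>d. exec_le c (d ## empty) (g (size d)) (f d ## empty)"
  shows "ptime f"
proof -
  obtain q where "\<And>n. g n \<le> poly q n" using assms(1) unfolding poly_bounded_def by blast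
  then show ?thesis using assms(2) exec_le_mono unfolding ptime_def by blast
qed

text \<open>The size bound comes from \<open>exec_size\<close>. It is what lets the cost of later
  programs be expressed in the size of the original input.\<close>

lemma ptimeE:
  assumes "ptime f"
  obtains c q where "\<And>d. exec_le c (d ## empty) (poly q (size d)) (f d ## empty)"
    "\<And>d. size (f d) \<le> size d + poly q (size d)"
proof -
  obtain c q where cq: "\<And>d. exec_le c (d ## empty) (poly q (size d)) (f d ## empty)"
    using assms unfolding ptime_def by blast
  have "size (f d) \<le> size d + poly q (size d)" for d
  proof -
    obtain t where "t \<le> poly q (size d)" "exec c (d ## empty) t (f d ## empty)"
      using cq[of d] unfolding exec_le_def by blast
    then show ?thesis using exec_size[of c "d ## empty" t "f d ## empty" 0] by simp
  qed
  with cq show ?thesis using that by blast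
qed

lemma ptime_size:
  assumes "ptime f"
  obtains q where "\<And>d. size (f d) \<le> poly q (size d)"
proof -
  obtain c q where "\<And>d. size (f d) \<le> size d + poly q (size d)"
    using assms ptimeE by metis
  then have "\<And>d. size (f d) \<le> poly ([:0, 1:] + q) (size d)" by simp
  then show ?thesis using that by blast
qed

section \<open>Closure properties of polynomial-time functions\<close>

lemma ptime_ident: "ptime (\<lambda>d. d)"
proof (rule ptimeI)
  show "exec_le Skip (d ## empty) 1 (d ## empty)" for d
    unfolding exec_le_def using exec.Skip by blast
qed (rule poly_bounded_const)

lemma ptime_Leaf: "ptime (\<lambda>d. Leaf)"
proof (rule ptimeI)
  show "exec_le (Assign 0 NilE) (d ## empty) 2 (Leaf ## empty)" for d
    by (rule exec_le_mono, rule exec_le_Assign) auto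
qed (rule poly_bounded_const)

lemma ptime_comp:
  assumes "ptime f" "ptime g"
  shows "ptime (\<lambda>d. f (g d))"
proof -
  obtain c q where f: "\<And>d. exec_le c (d ## empty) (poly q (size d)) (f d ## empty)"
    using ptimeE[OF assms(1)] by metis
  obtain c' q' where g: "\<And>d. exec_le c' (d ## empty) (poly q' (size d)) (g d ## empty)"
      "\<And>d. size (g d) \<le> size d + poly q' (size d)"
    using ptimeE[OF assms(2)] by metis
  show ?thesis
  proof (rule ptimeI)
    show "exec_le (Seq c' c) (d ## empty)
        (1 + poly q' (size d) + poly q (size d + poly q' (size d))) (f (g d) ## empty)" for d
      by (rule exec_le_mono[OF exec_le_Seq[OF g(1) f]]) (simp add: g(2) poly_nat_mono)
  qed (intro poly_bounded_intros)
qed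

lemma size_hd_tree: "size (hd_tree d) \<le> size d"
  by (cases d) auto

lemma size_tl_tree: "size (tl_tree d) \<le> size d"
  by (cases d) auto

lemma ptime_hd: "ptime f \<Longrightarrow> ptime (\<lambda>d. hd_tree (f d))"
proof (rule ptime_comp[where f = hd_tree], rule ptimeI)
  show "exec_le (Assign 0 (HdE (VarE 0))) (d ## empty) (3 + 2 * size d) (hd_tree d ## empty)" for d
    by (rule exec_le_mono, rule exec_le_Assign) (auto simp: size_hd_tree)
qed (intro poly_bounded_intros)

lemma ptime_tl: "ptime f \<Longrightarrow> ptime (\<lambda>d. tl_tree (f d))"
proof (rule ptime_comp[where f = tl_tree], rule ptimeI)
  show "exec_le (Assign 0 (TlE (VarE 0))) (d ## empty) (3 + 2 * size d) (tl_tree d ## empty)" for d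
    by (rule exec_le_mono, rule exec_le_Assign) (auto simp: size_tl_tree)
qed (intro poly_bounded_intros)

lemma ptime_Node:
  assumes "ptime f" "ptime g"
  shows "ptime (\<lambda>d. Node (f d) (g d))"
proof -
  obtain c q where f: "\<And>d. exec_le c (d ## empty) (poly q (size d)) (f d ## empty)"
      "\<And>d. size (f d) \<le> size d + poly q (size d)"
    using ptimeE[OF assms(1)] by metis
  obtain c' q' where g: "\<And>d. exec_le c' (d ## empty) (poly q' (size d)) (g d ## empty)"
      "\<And>d. size (g d) \<le> size d + poly q' (size d)"
    using ptimeE[OF assms(2)] by metis
  \<comment> \<open>Both programs run on variable 1. Variable 2 carries the input while
    \<open>f d\<close> moves to variable 0, and it is reset because \<open>lift c'\<close> expects
    all variables beyond its input to be empty.\<close>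
  let ?c = "Seq (Assign (Suc 0) (VarE 0)) (Seq (lift c)
    (Seq (Assign (Suc (Suc 0)) (VarE 0)) (Seq (Assign 0 (VarE (Suc 0)))
    (Seq (Assign (Suc 0) (VarE (Suc (Suc 0)))) (Seq (Assign (Suc (Suc 0)) NilE) (Seq (lift c')
    (Seq (Assign 0 (ConsE (VarE 0) (VarE (Suc 0)))) (Assign (Suc 0) NilE))))))))"
  show ?thesis
  proof (rule ptimeI)
    show "exec_le ?c (d ## empty)
        (50 + 20 * size d + 20 * poly q (size d) + 20 * poly q' (size d))
        (Node (f d) (g d) ## empty)" for d
      apply (rule exec_le_mono)
       apply (rule exec_le_Seq, rule exec_le_Assign, rule refl)
       apply (rule exec_le_Seq, simp, rule exec_le_lift, rule f(1))
       apply (rule exec_le_Seq, rule exec_le_Assign, rule refl)+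
       apply (rule exec_le_Seq, simp, rule exec_le_lift, rule g(1))
       apply (rule exec_le_Seq, rule exec_le_Assign, rule refl, rule exec_le_Assign, simp)
      using f(2)[of d] g(2)[of d] by simp
  qed (intro poly_bounded_intros)
qed

lemma ptime_if:
  assumes "ptime b" "ptime f" "ptime g"
  shows "ptime (\<lambda>d. if b d = Leaf then f d else g d)"
proof -
  obtain cb qb where b: "\<And>d. exec_le cb (d ## empty) (poly qb (size d)) (b d ## empty)"
      "\<And>d. size (b d) \<le> size d + poly qb (size d)"
    using ptimeE[OF assms(1)] by metis
  obtain c q where f: "\<And>d. exec_le c (d ## empty) (poly q (size d)) (f d ## empty)"
    using ptimeE[OF assms(2)] by metis
  obtain c' q' where g: "\<And>d. exec_le c' (d ## empty) (poly q' (size d)) (g d ## empty)"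
    using ptimeE[OF assms(3)] by metis
  \<comment> \<open>\<open>IfC\<close> takes its first branch on values other than
    \<open>Leaf\<close>, so the program of \<open>g\<close> comes first.\<close>
  let ?c = "Seq (Assign (Suc 0) (VarE 0)) (Seq (lift cb) (IfC (VarE (Suc 0))
    (Seq (Assign (Suc 0) NilE) c') (Seq (Assign (Suc 0) NilE) c)))"
  show ?thesis
  proof (rule ptimeI)
    show "exec_le ?c (d ## empty)
        (50 + 20 * size d + 20 * poly qb (size d) + poly q (size d) + poly q' (size d))
        ((if b d = Leaf then f d else g d) ## empty)" for d
      apply (rule exec_le_mono)
       apply (rule exec_le_Seq, rule exec_le_Assign, rule refl)
       apply (rule exec_le_Seq, simp, rule exec_le_lift, rule b(1))
       apply (rule exec_le_If)
        apply (simp, rule exec_le_Seq, rule exec_le_Assign, rule refl, simp, rule g)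
       apply (simp, rule exec_le_Seq, rule exec_le_Assign, rule refl, simp, rule f)
      using b(2)[of d] by simp
  qed (intro poly_bounded_intros)
qed

section \<open>Structural recursion along lists\<close>

text \<open>The step function sees the whole suffix, not only its head: the length of the suffix
  tells the position in the list.\<close>

fun trec :: "(tree \<Rightarrow> tree \<Rightarrow> tree) \<Rightarrow> tree \<Rightarrow> tree \<Rightarrow> tree" where
  "trec h z Leaf = z"
| "trec h z (Node x xs) = h (Node x xs) (trec h z xs)"

text \<open>The language has no recursion, so \<open>trec\<close> is run as two loops. The first
  stacks the suffixes with the shortest on top, the order in which the second,
  \<open>consume\<close>, has to process them.\<close>

fun push_suffixes :: "tree \<Rightarrow> tree \<Rightarrow> tree" where
  "push_suffixes st Leaf = st"
| "push_suffixes st (Node x xs) = push_suffixes (Node (Node x xs) st) xs"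

fun consume :: "(tree \<Rightarrow> tree \<Rightarrow> tree) \<Rightarrow> tree \<Rightarrow> tree \<Rightarrow> tree" where
  "consume h a Leaf = a"
| "consume h a (Node u st) = consume h (h u a) st"

lemma consume_push_suffixes: "consume h z (push_suffixes st xs) = consume h (trec h z xs) st"
  by (induction xs arbitrary: st) auto

text \<open>At most \<open>size xs\<close> suffixes are stacked, each of size at most
  \<open>size xs\<close> and with one node to hold it.\<close>

lemma size_push_suffixes: "size (push_suffixes st xs) \<le> size st + size xs * (size xs + 1)"
proof (induction xs arbitrary: st)
  case (Node x xs)
  then show ?case using Node(2)[of "Node (Node x xs) st"] by (simp add: algebra_simps)
qed simp

abbreviation (input) "V1 \<equiv> Suc 0"
abbreviation (input) "V2 \<equiv> Suc (Suc 0)"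
abbreviation (input) "V3 \<equiv> Suc (Suc (Suc 0))"

text \<open>Variable 0 is the stack and variable 3 the rest of the list. Variables 1 and 2 keep the
  parameter and the start value for the second loop.\<close>

definition suffix_loop :: com where
  "suffix_loop = WhileC (VarE V3)
     (Seq (Assign 0 (ConsE (VarE V3) (VarE 0))) (Assign V3 (TlE (VarE V3))))"

text \<open>The fixed \<open>B\<close> bounds stack and list throughout, so each of the at most
  \<open>size xs\<close> rounds and the final test can be charged the same amount.\<close>

lemma exec_suffix_loop:
  "size st + size xs * (size xs + 1) \<le> B \<Longrightarrow>
   exec_le suffix_loop (st ## e ## a ## xs ## empty) ((size xs + 1) * (20 + 20 * B))
     (push_suffixes st xs ## e ## a ## empty)"
proof (induction xs arbitrary: st)
  case Leaf
  show ?case unfolding suffix_loop_def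
    by (rule exec_le_mono, simp, rule exec_le_WhileFalse) (auto simp: empty_apply)
next
  case (Node x xs)
  let ?n = "size (Node x xs)"
  have le: "size (Node (Node x xs) st) + size xs * (size xs + 1) \<le> B"
    using Node.prems by (simp add: algebra_simps)
  have n: "?n \<le> B" "size st \<le> B" using Node.prems by auto
  have "exec_le suffix_loop (st ## e ## a ## Node x xs ## empty)
     ((20 + 20 * B) + (size xs + 1) * (20 + 20 * B))
     (push_suffixes st (Node x xs) ## e ## a ## empty)"
    unfolding suffix_loop_def
    apply (rule exec_le_mono)
     apply (rule exec_le_WhileTrue, simp)
      apply (rule exec_le_Seq, rule exec_le_Assign, rule refl, rule exec_le_Assign, rule refl)
     apply (simp, rule Node.IH(2)[OF le, unfolded suffix_loop_def])
    using n by simp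
  moreover have "(20 + 20 * B) + (size xs + 1) * (20 + 20 * B) \<le> (?n + 1) * (20 + 20 * B)"
    by (simp add: algebra_simps)
  ultimately show ?case by (rule exec_le_mono)
qed

text \<open>Variable 3 passes the packed arguments to \<open>c\<close> and receives its result;
  being the last variable in use, it offers \<open>c\<close> a clean state after three
  lifts.\<close>

definition consume_loop :: "com \<Rightarrow> com" where
  "consume_loop c = WhileC (VarE 0)
     (Seq (Assign V3 (ConsE (VarE V1) (ConsE (HdE (VarE 0)) (VarE V2))))
     (Seq (lift (lift (lift c))) (Seq (Assign V2 (VarE V3)) (Seq (Assign V3 NilE)
     (Assign 0 (TlE (VarE 0)))))))"

text \<open>\<open>S\<close> bounds the stack and \<open>A\<close> every accumulator. The premise on
  \<open>A\<close> is invariant: a round takes at least one node off the stack and adds at most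
  \<open>poly b (size e + S)\<close> to the accumulator.\<close>

lemma exec_consume_loop:
  assumes c: "\<And>u a. exec_le c (Node e (Node u a) ## empty) (poly q (size (Node e (Node u a))))
      (h u a ## empty)"
    and h: "\<And>u a. size (h u a) \<le> size a + poly b (size e + size u)"
  shows "size st \<le> S \<Longrightarrow> size a + size st * poly b (size e + S) \<le> A \<Longrightarrow>
    exec_le (consume_loop c) (st ## e ## a ## empty)
      ((size st + 1) * (50 + 20 * (size e + S + A) + poly q (size e + S + A + 2)))
      (Leaf ## e ## consume h a st ## empty)"
proof (induction st arbitrary: a)
  case Leaf
  show ?case unfolding consume_loop_def
    by (rule exec_le_mono, simp, rule exec_le_WhileFalse) (auto simp: empty_apply)
next
  case (Node u st)
  let ?G = "poly b (size e + S)"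
  let ?T = "50 + 20 * (size e + S + A) + poly q (size e + S + A + 2)"
  have "poly b (size e + size u) \<le> ?G"
    using Node.prems(1) by (intro poly_nat_mono) simp
  then have ha: "size (h u a) \<le> size a + ?G" using h[of u a] by linarith
  have "size a + ?G + size st * ?G \<le> size a + size (Node u st) * ?G"
    by (simp add: algebra_simps)
  then have ha_st: "size (h u a) + size st * ?G \<le> A"
    using ha Node.prems(2) by linarith
  have IH: "exec_le (consume_loop c) (st ## e ## h u a ## empty)
      ((size st + 1) * ?T) (Leaf ## e ## consume h (h u a) st ## empty)"
    using Node.IH(2) ha_st Node.prems(1) by simp
  have sizes: "size u + size st + 1 \<le> S" "size a \<le> A" "size (h u a) \<le> A"
    using ha_st Node.prems by simp_all
  have q: "poly q (size (Node e (Node u a))) \<le> poly q (size e + S + A + 2)"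
    using sizes by (intro poly_nat_mono) simp
  have "exec_le (consume_loop c) (Node u st ## e ## a ## empty)
     (?T + (size st + 1) * ?T) (Leaf ## e ## consume h (h u a) st ## empty)"
    unfolding consume_loop_def
    apply (rule exec_le_mono)
     apply (rule exec_le_WhileTrue, simp)
      apply (rule exec_le_Seq, rule exec_le_Assign, rule refl)
      apply (simp, rule exec_le_Seq, (rule exec_le_lift)+, rule c)
      apply (rule exec_le_Seq, rule exec_le_Assign, rule refl)+
      apply (rule exec_le_Assign, rule refl)
     apply (simp, rule IH[unfolded consume_loop_def])
    using sizes q by simp
  moreover have "?T + (size st + 1) * ?T \<le> (size (Node u st) + 1) * ?T"
    by (simp add: algebra_simps)
  ultimately show ?case by (auto elim: exec_le_mono)
qed

lemma size_consume:
  assumes "\<And>u a. size (h u a) \<le> size a + poly b (m + size u)"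
  shows "size st \<le> S \<Longrightarrow> size (consume h a st) \<le> size a + size st * poly b (m + S)"
proof (induction st arbitrary: a)
  case (Node u st)
  have "poly b (m + size u) \<le> poly b (m + S)"
    using Node.prems(1) by (intro poly_nat_mono) simp
  then show ?case
    using Node.IH(2)[of "h u a"] assms[of u a] Node.prems by (simp add: algebra_simps)
qed simp

text \<open>Without the growth condition, intermediate results could become exponentially large.\<close>

lemma ptime_trec:
  assumes h: "ptime (\<lambda>w. h (hd_tree w) (hd_tree (tl_tree w)) (tl_tree (tl_tree w)))"
    and growth: "\<And>d u a. size (h d u a) \<le> size a + poly b (size d + size u)"
    and z: "ptime z" and xs: "ptime xs"
  shows "ptime (\<lambda>d. trec (h d) (z d) (xs d))"
proof -
  obtain c q where c: "\<And>d. exec_le c (d ## empty) (poly q (size d))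
      (h (hd_tree d) (hd_tree (tl_tree d)) (tl_tree (tl_tree d)) ## empty)"
    using ptimeE[OF h] by metis
  have c: "exec_le c (Node d (Node u a) ## empty) (poly q (size (Node d (Node u a)))) (h d u a ## empty)"
    for d u a
    using c[of "Node d (Node u a)"] by simp
  \<comment> \<open>List, parameter and start value are packed into one tree, since
    \<open>ptime\<close> speaks of unary functions. Below, \<open>S\<close> bounds the stack for
    inputs of size \<open>n\<close>, and \<open>A\<close> the accumulator after at most
    \<open>S n\<close> rounds.\<close>
  define L where "L = (\<lambda>w. trec (h (hd_tree (tl_tree w))) (tl_tree (tl_tree w)) (hd_tree w))"
  define S :: "nat \<Rightarrow> nat" where "S n = n * (n + 1)" for n
  define A :: "nat \<Rightarrow> nat" where "A n = n + S n * poly b (n + S n)" for n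
  let ?c = "Seq (Assign V1 (HdE (TlE (VarE 0)))) (Seq (Assign V2 (TlE (TlE (VarE 0))))
    (Seq (Assign V3 (HdE (VarE 0))) (Seq (Assign 0 NilE) (Seq suffix_loop (Seq (consume_loop c)
    (Seq (Assign 0 (VarE V2)) (Seq (Assign V1 NilE) (Assign V2 NilE))))))))"
  let ?T = "\<lambda>n. 100 + 50 * n + (n + 1) * (20 + 20 * S n)
    + (S n + 1) * (50 + 20 * (n + S n + A n) + poly q (n + S n + A n + 2)) + 5 * A n"
  have "ptime L"
  proof (rule ptimeI)
    fix w
    define x where "x = hd_tree w"
    define e where "e = hd_tree (tl_tree w)"
    define a where "a = tl_tree (tl_tree w)"
    define n where "n = size w"
    have xle: "size x \<le> n" and tl: "size (tl_tree w) \<le> n" and ele: "size e \<le> n" and ale: "size a \<le> n"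
      unfolding x_def e_def a_def n_def
      by (meson size_hd_tree size_tl_tree le_trans)+
    have S: "size Leaf + size x * (size x + 1) \<le> S n"
      unfolding S_def using xle by (auto intro: add_mono mult_mono)
    define st where "st = push_suffixes Leaf x"
    have st: "size st \<le> S n"
      using size_push_suffixes[of Leaf x] S unfolding st_def by linarith
    have "size st * poly b (size e + S n) \<le> S n * poly b (n + S n)"
      using st ele by (intro mult_mono poly_nat_mono) auto
    then have A: "size a + size st * poly b (size e + S n) \<le> A n"
      unfolding A_def using ale by linarith
    have res: "size (consume (h e) a st) \<le> A n"
      using size_consume[of "h e" b "size e", OF growth st, of a] A by linarith
    have Lw: "L w = consume (h e) a st"
      unfolding L_def st_def consume_push_suffixes by (simp add: x_def e_def a_def)
    have t1: "(size x + 1) * (20 + 20 * S n) \<le> (n + 1) * (20 + 20 * S n)"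
      using xle by (intro mult_mono) auto
    have "poly q (size e + S n + A n + 2) \<le> poly q (n + S n + A n + 2)"
      using ele by (intro poly_nat_mono) auto
    then have t2: "(size st + 1) * (50 + 20 * (size e + S n + A n) + poly q (size e + S n + A n + 2))
      \<le> (S n + 1) * (50 + 20 * (n + S n + A n) + poly q (n + S n + A n + 2))"
      using st ele by (intro mult_mono add_mono) auto
    \<comment> \<open>With both loop bounds folded into constants, the remaining estimate of the
      total time is linear.\<close>
    define T1 where "T1 = (n + 1) * (20 + 20 * S n)"
    define T2 where "T2 = (S n + 1) * (50 + 20 * (n + S n + A n) + poly q (n + S n + A n + 2))"
    note loop1 = exec_le_mono[OF exec_suffix_loop[OF S] t1, folded T1_def st_def]
    note loop2 = exec_le_mono[OF exec_consume_loop[OF c growth st A] t2, folded T2_def]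
    have "exec_le ?c (w ## empty) (?T n) (consume (h e) a st ## empty)"
      apply (rule exec_le_mono)
       apply (rule exec_le_Seq, rule exec_le_Assign, rule refl)+
       apply (rule exec_le_Seq, simp add: x_def[symmetric] e_def[symmetric] a_def[symmetric],
          rule loop1)
       apply (rule exec_le_Seq, rule loop2)
       apply (rule exec_le_Seq, rule exec_le_Assign, rule refl)+
       apply (rule exec_le_Assign, simp)
      unfolding T1_def[symmetric] T2_def[symmetric]
      using xle tl ele ale res
      by (simp add: x_def[symmetric] e_def[symmetric] a_def[symmetric] n_def[symmetric])
    then show "exec_le ?c (w ## empty) (?T (size w)) (L w ## empty)"
      unfolding Lw n_def .
  qed (unfold A_def S_def, intro poly_bounded_intros)
  then have "ptime (\<lambda>d. L (Node (xs d) (Node d (z d))))"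
    by (rule ptime_comp) (intro ptime_Node xs z ptime_ident)
  then show ?thesis by (simp add: L_def)
qed

lemma ptime_computes_in:
  assumes "ptime f"
  obtains c q where "\<And>d. \<exists>t. computes_in c d (f d) t \<and> t \<le> poly q (size d)"
proof -
  obtain c q where c: "\<And>d. exec_le c (d ## empty) (poly q (size d)) (f d ## empty)"
    using assms unfolding ptime_def by blast
  have "\<exists>t. computes_in c d (f d) t \<and> t \<le> poly q (size d)" for d
  proof -
    have "(\<lambda>_. Leaf)(0 := d) = d ## empty"
      using push_update(3) unfolding empty_def .
    then show ?thesis
      using c[of d] unfolding exec_le_def computes_in_def by (metis push_apply(1))
  qed
  then show ?thesis using that by blast
qed

lemmas ptime_intros = ptime_ident ptime_Leaf ptime_hd ptime_tl ptime_Node ptime_if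

lemma ptime_size2:
  assumes "ptime (\<lambda>w. f (hd_tree w) (tl_tree w))"
  obtains b where "\<And>d u. size (f d u) \<le> poly b (size d + size u)"
proof -
  obtain q where q: "\<And>w. size (f (hd_tree w) (tl_tree w)) \<le> poly q (size w)"
    using ptime_size[OF assms] by blast
  \<comment> \<open>The inner polynomial 1 + X accounts for the node that joins \<open>d\<close> and
    \<open>u\<close>.\<close>
  have "size (f d u) \<le> poly (pcompose q [:1, 1:]) (size d + size u)" for d u
    using q[of "Node d u"] by (simp add: poly_pcompose)
  then show ?thesis using that by blast
qed

text \<open>The growth of a step is bounded by the output of another polynomial-time function
  \<open>f\<close>, typically the piece that the step adds; no explicit polynomial has to be
  given.\<close>

lemma ptime_rec:
  assumes h: "ptime (\<lambda>w. h (hd_tree w) (hd_tree (tl_tree w)) (tl_tree (tl_tree w)))"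
    and f: "ptime (\<lambda>w. f (hd_tree w) (tl_tree w))"
    and growth: "\<And>d u a. size (h d u a) \<le> size a + size (f d u)"
    and "ptime z" "ptime xs"
  shows "ptime (\<lambda>d. trec (h d) (z d) (xs d))"
proof -
  obtain b where b: "\<And>d u. size (f d u) \<le> poly b (size d + size u)"
    using ptime_size2[OF f] by blast
  show ?thesis
  proof (rule ptime_trec[OF h _ assms(4,5)])
    show "size (h d u a) \<le> size a + poly b (size d + size u)" for d u a
      using growth[of d u a] b[of d u] by linarith
  qed
qed

section \<open>List operations and arithmetic on codes of numbers\<close>

text \<open>\<open>f\<close> receives suffixes, whose heads are the list elements, so that it can
  recover the index of an element.\<close>

definition tmap :: "(tree \<Rightarrow> tree) \<Rightarrow> tree \<Rightarrow> tree" where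
  "tmap f = trec (\<lambda>u r. Node (f u) r) Leaf"

lemma ptime_tmap:
  assumes f: "ptime (\<lambda>w. f (hd_tree w) (tl_tree w))" and "ptime xs"
  shows "ptime (\<lambda>d. tmap (f d) (xs d))"
  unfolding tmap_def
proof (rule ptime_rec[where f = "\<lambda>d u. Node (f d u) Leaf" and h = "\<lambda>d u r. Node (f d u) r"])
  have "ptime (\<lambda>w. Node (hd_tree w) (hd_tree (tl_tree w)))" by (intro ptime_intros)
  from ptime_comp[OF f this]
  show "ptime (\<lambda>w. Node (f (hd_tree w) (hd_tree (tl_tree w))) (tl_tree (tl_tree w)))"
    by (intro ptime_intros) simp
qed (use assms in \<open>auto intro: ptime_intros\<close>)

lemma list_tree_simps [simp]:
  "list_tree [] = Leaf"
  "list_tree (t # ts) = Node t (list_tree ts)"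
  by (simp_all add: list_tree_def)

lemma list_tree_eq_Leaf [simp]: "list_tree ts = Leaf \<longleftrightarrow> ts = []"
  by (cases ts) auto

lemma unary_simps [simp]: "unary 0 = Leaf" "unary (Suc n) = Node Leaf (unary n)"
  by (simp_all add: unary_def)

lemma tmap_simps [simp]:
  "tmap f Leaf = Leaf"
  "tmap f (Node t ts) = Node (f (Node t ts)) (tmap f ts)"
  by (simp_all add: tmap_def)

lemma tmap_hd: "tmap (\<lambda>u. g (hd_tree u)) (list_tree (map f xs)) = list_tree (map (\<lambda>x. g (f x)) xs)"
  by (induction xs) auto

lemma tmap_suffixes:
  "tmap f (list_tree ts) = list_tree (map (\<lambda>i. f (list_tree (drop i ts))) [0..<length ts])"
proof (induction ts)
  case (Cons t ts)
  then show ?case by (simp add: upt_conv_Cons map_Suc_upt[symmetric] o_def del: upt_Suc)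
qed simp

text \<open>For unary \<open>b\<close> this is addition. For the binary code \<open>b\<close> of a
  positive number, least significant bit first, it is a shift: multiplication by a power of
  two.\<close>

definition uadd :: "tree \<Rightarrow> tree \<Rightarrow> tree" where
  "uadd a b = trec (\<lambda>u r. Node Leaf r) b a"

lemma ptime_uadd: "ptime f \<Longrightarrow> ptime g \<Longrightarrow> ptime (\<lambda>d. uadd (f d) (g d))"
  unfolding uadd_def
  by (rule ptime_rec[where f = "\<lambda>d u. Node Leaf Leaf" and h = "\<lambda>d u r. Node Leaf r"])
    (auto intro!: ptime_intros)

lemma uadd_simps [simp]: "uadd Leaf b = b" "uadd (Node x a) b = Node Leaf (uadd a b)"
  by (simp_all add: uadd_def)

lemma uadd_unary [simp]: "uadd (unary a) (unary b) = unary (a + b)"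
  by (induction a) auto

lemma size_uadd: "size (uadd a b) \<le> size b + size a"
  by (induction a) auto

definition umul :: "tree \<Rightarrow> tree \<Rightarrow> tree" where
  "umul a b = trec (\<lambda>u r. uadd b r) Leaf a"

lemma ptime_umul:
  assumes "ptime f" "ptime g"
  shows "ptime (\<lambda>d. umul (f d) (g d))"
  unfolding umul_def
  by (rule ptime_rec[where f = "\<lambda>d u. g d" and h = "\<lambda>d u r. uadd (g d) r"])
    (auto intro!: ptime_intros ptime_uadd assms ptime_comp[OF assms(2)] size_uadd)

lemma umul_unary [simp]: "umul (unary a) (unary b) = unary (a * b)"
  by (induction a) (auto simp: umul_def)

definition btrue :: tree where "btrue = Node Leaf Leaf"

text \<open>The incremented tail \<open>r\<close> is used only while a carry passes through;
  otherwise the unchanged tail is read from the suffix \<open>u\<close>.\<close>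

definition binc :: "tree \<Rightarrow> tree" where
  "binc = trec (\<lambda>u r. if hd_tree u = Leaf then Node btrue (tl_tree u) else Node Leaf r)
     (Node btrue Leaf)"

lemma ptime_binc: "ptime f \<Longrightarrow> ptime (\<lambda>d. binc (f d))"
  unfolding binc_def btrue_def
proof (rule ptime_rec[where f = "\<lambda>d u. Node (Node Leaf Leaf) u"
      and h = "\<lambda>d u r. if hd_tree u = Leaf then Node (Node Leaf Leaf) (tl_tree u) else Node Leaf r"])
  show "size (if hd_tree u = Leaf then Node (Node Leaf Leaf) (tl_tree u) else Node Leaf a)
    \<le> size a + size (Node (Node Leaf Leaf) u)" for u a
    using size_tl_tree[of u] by auto
qed (auto intro!: ptime_intros)

lemma binc_simps [simp]:
  "binc Leaf = Node btrue Leaf"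
  "binc (Node b bs) = (if b = Leaf then Node btrue bs else Node Leaf (binc bs))"
  by (simp_all add: binc_def)

lemma size_binc: "size (binc b) \<le> size b + 2"
  by (induction b) (auto simp: btrue_def)

lemma binary_0 [simp]: "binary 0 = Leaf"
  by (simp add: binary.simps)

lemma binc_binary: "binc (binary n) = binary (Suc n)"
proof (induction n rule: binary.induct)
  case (1 n)
  show ?case
  proof (cases "n = 0")
    case True
    then show ?thesis by (simp add: binary.simps[of "Suc 0"] bool_tree_def btrue_def)
  next
    case False
    then show ?thesis
      using 1 by (cases "odd n")
        (auto simp: binary.simps[of n] binary.simps[of "Suc n"] bool_tree_def btrue_def elim: oddE)
  qed
qed

definition to_binary :: "tree \<Rightarrow> tree" where
  "to_binary = trec (\<lambda>u r. binc r) Leaf"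

lemma ptime_to_binary: "ptime f \<Longrightarrow> ptime (\<lambda>d. to_binary (f d))"
  unfolding to_binary_def
\<comment> \<open>The constant tree has size 2, the growth of one increment according to
  \<open>size_binc\<close>.\<close>
proof (rule ptime_rec[where f = "\<lambda>d u. Node (Node Leaf Leaf) Leaf" and h = "\<lambda>d u r. binc r"])
  show "size (binc a) \<le> size a + size (Node (Node Leaf Leaf) Leaf)" for a
    using size_binc[of a] by simp
qed (auto intro!: ptime_intros ptime_binc)

lemma to_binary_unary [simp]: "to_binary (unary n) = binary n"
  by (induction n) (auto simp: to_binary_def binc_binary)

text \<open>Serves as list indexing, as truncated subtraction of unary numbers and, by comparing the
  result with \<open>Leaf\<close>, as their order.\<close>

definition tdrop :: "tree \<Rightarrow> tree \<Rightarrow> tree" where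
  "tdrop a b = trec (\<lambda>u r. tl_tree r) b a"

lemma ptime_tdrop: "ptime f \<Longrightarrow> ptime g \<Longrightarrow> ptime (\<lambda>d. tdrop (f d) (g d))"
  unfolding tdrop_def
  by (rule ptime_rec[where f = "\<lambda>d u. Leaf" and h = "\<lambda>d u r. tl_tree r"])
    (auto intro!: ptime_intros simp: size_tl_tree)

lemma tl_list_tree [simp]: "tl_tree (list_tree ts) = list_tree (tl ts)"
  by (cases ts) auto

lemma hd_list_tree: "ts \<noteq> [] \<Longrightarrow> hd_tree (list_tree ts) = hd ts"
  by (cases ts) auto

lemma tdrop_list_tree: "tdrop (list_tree us) (list_tree ts) = list_tree (drop (length us) ts)"
  by (induction us) (auto simp: tdrop_def tl_drop drop_Suc)

definition tsum :: "(tree \<Rightarrow> tree) \<Rightarrow> tree \<Rightarrow> tree" where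
  "tsum f = trec (\<lambda>u r. uadd (f (hd_tree u)) r) Leaf"

lemma ptime_tsum:
  assumes f: "ptime (\<lambda>w. f w)" and "ptime xs"
  shows "ptime (\<lambda>d. tsum f (xs d))"
  unfolding tsum_def
  by (rule ptime_rec[where f = "\<lambda>d u. f (hd_tree u)" and h = "\<lambda>d u r. uadd (f (hd_tree u)) r"])
    (auto intro!: ptime_intros ptime_uadd ptime_comp[OF f] assms size_uadd)

lemma tsum_list:
  assumes "\<And>x. x \<in> set xs \<Longrightarrow> f (t x) = unary (g x)"
  shows "tsum f (list_tree (map t xs)) = unary (sum_list (map g xs))"
  using assms by (induction xs) (auto simp: tsum_def)

section \<open>Piecewise linear processing time functions\<close>

text \<open>Between two points \<open>(a, b)\<close> and \<open>(a', b')\<close>, the derivative of \<open>s * f s\<close> is smallest at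
  \<open>a'\<close>; it is non-negative there iff \<open>a' * (b - b') \<le> b' * (a' - a)\<close>.\<close>

fun admissible :: "(rat \<times> rat) list \<Rightarrow> bool" where
  "admissible [] \<longleftrightarrow> False"
| "admissible [(a, b)] \<longleftrightarrow> 0 < a \<and> 0 \<le> b"
| "admissible ((a, b) # (a', b') # ps) \<longleftrightarrow> 0 < a \<and> a < a' \<and> b' \<le> b \<and>
     a' * (b - b') \<le> b' * (a' - a) \<and> admissible ((a', b') # ps)"

lemma interpolate_le_first: "s \<le> real_of_rat a \<Longrightarrow> interpolate ((a, b) # ps) s = real_of_rat b"
  by (cases ps) auto

lemma interpolate_ge_second:
  assumes "a < a'" "real_of_rat a' \<le> s"
  shows "interpolate ((a, b) # (a', b') # ps) s = interpolate ((a', b') # ps) s"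
proof (cases "s = real_of_rat a'")
  case True
  have "real_of_rat a < real_of_rat a'" using assms by (simp add: of_rat_less)
  with True show ?thesis using assms
    by (simp add: interpolate_le_first of_rat_divide of_rat_diff not_le)
next
  case False
  then have "real_of_rat a' < s" using assms by simp
  moreover have "real_of_rat a < real_of_rat a'" using assms by (simp add: of_rat_less)
  ultimately show ?thesis by simp
qed

text \<open>For slope \<open>m \<le> 0\<close>, the difference \<open>t * L t - s * L s\<close> on
  the sloped part is \<open>t - s\<close> times \<open>b - m * a + m * (t + s)\<close>. The second
  factor is smallest at \<open>s = t = a'\<close>, where it equals \<open>m * a' + b'\<close>,
  non-negative by the third assumption. If \<open>a\<close> separates \<open>s\<close> and
  \<open>t\<close>, it serves as an intermediate point.\<close>

lemma linear_piece_mono: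
  fixes a b a' b' s t :: real
  assumes "a < a'" "b' \<le> b" "a' * (b - b') \<le> b' * (a' - a)" "0 < a" "0 \<le> b'"
    and L: "\<And>x. L x = (if x \<le> a then b else b + (b' - b) / (a' - a) * (x - a))"
    and st: "0 < s" "s \<le> t" "t \<le> a'"
  shows "L t \<le> L s \<and> s * L s \<le> t * L t"
proof -
  define m where "m = (b' - b) / (a' - a)"
  have m: "m \<le> 0" unfolding m_def using assms by (simp add: divide_nonpos_pos)
  have b': "b' = b + m * (a' - a)" unfolding m_def using assms by simp
  have "b - b' = - (m * (a' - a))" using b' by simp
  with assms(3) have "a' * - (m * (a' - a)) \<le> b' * (a' - a)" by simp
  then have "(m * a' + b') * (a' - a) \<ge> 0" by (simp add: algebra_simps)
  then have ma: "m * a' + b' \<ge> 0" using assms(1) by (simp add: zero_le_mult_iff)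
  have L': "L x = (if x \<le> a then b else b + m * (x - a))" for x using L m_def by simp
  have lin: "s * (b + m * (s - a)) \<le> t * (b + m * (t - a))" if "s \<le> t" "t \<le> a'" for s t
  proof -
    have "m * (t + s) \<ge> m * (2 * a')" using m that by (intro mult_left_mono_neg) auto
    then have "0 \<le> (t - s) * (b - m * a + m * (t + s))"
      using ma b' that by (intro mult_nonneg_nonneg) (auto simp: algebra_simps)
    then show ?thesis by (simp add: algebra_simps)
  qed
  have dec: "m * (t - a) \<le> m * (s - a)" if "s \<le> t" for s t
    using m that by (intro mult_left_mono_neg) auto
  consider "t \<le> a" | "s \<le> a" "a < t" | "a < s" using st by linarith
  then show ?thesis
  proof cases
    case 1
    then show ?thesis using st assms L' by (auto intro: mult_right_mono)
  next
    case 2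
    have "s * b \<le> a * b" using 2 assms by (intro mult_right_mono) auto
    moreover have "a * b \<le> t * (b + m * (t - a))" using lin[of a t] 2 st by simp
    ultimately have "s * b \<le> t * (b + m * (t - a))" by linarith
    moreover have "m * (t - a) \<le> 0" using m 2 by (simp add: mult_nonpos_nonneg)
    ultimately show ?thesis using 2 L' by simp
  next
    case 3
    then show ?thesis using lin[of s t] dec[of s t] st L' by simp
  qed
qed

text \<open>The values decrease along the list, and the last one is non-negative.\<close>

lemma admissible_last_nonneg: "admissible ((a, b) # ps) \<Longrightarrow> 0 \<le> b"
  by (induction ps arbitrary: a b) force+

text \<open>The first piece and the interpolation of the tail agree at \<open>a'\<close>, so
  monotonicity on either side combines through this point.\<close>

lemma interpolate_mono:
  assumes "admissible ps" "0 < s" "s \<le> t"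
  shows "interpolate ps t \<le> interpolate ps s \<and> s * interpolate ps s \<le> t * interpolate ps t"
  using assms
proof (induction ps arbitrary: s t rule: admissible.induct)
  case (2 a b)
  then show ?case by (auto intro: mult_right_mono)
next
  case (3 a b a' b' ps)
  let ?f = "interpolate ((a, b) # (a', b') # ps)"
  define L where "L x = (if x \<le> real_of_rat a then real_of_rat b else
    real_of_rat b + (real_of_rat b' - real_of_rat b) / (real_of_rat a' - real_of_rat a) *
      (x - real_of_rat a))" for x
  have ab: "0 < a" "a < a'" "b' \<le> b" "a' * (b - b') \<le> b' * (a' - a)" "0 \<le> b'"
    using 3(2) admissible_last_nonneg[of a' b' ps] by auto
  have "real_of_rat (a' * (b - b')) \<le> real_of_rat (b' * (a' - a))"
    using ab(4) by (simp only: of_rat_less_eq)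
  then have ab': "real_of_rat a' * (real_of_rat b - real_of_rat b')
      \<le> real_of_rat b' * (real_of_rat a' - real_of_rat a)"
    by (simp add: of_rat_mult of_rat_diff)
  have L: "?f x = L x" if "x \<le> real_of_rat a'" for x
    using that by (simp add: L_def of_rat_divide of_rat_diff)
  have piece: "L t \<le> L s \<and> s * L s \<le> t * L t" if "0 < s" "s \<le> t" "t \<le> real_of_rat a'" for s t
    by (rule linear_piece_mono[where a' = "real_of_rat a'" and b' = "real_of_rat b'"])
      (use ab ab' that L_def in \<open>auto simp: of_rat_less of_rat_less_eq\<close>)
  have tail: "?f x = interpolate ((a', b') # ps) x" if "real_of_rat a' \<le> x" for x
    using interpolate_ge_second[OF ab(2) that] .
  have IH: "?f t \<le> ?f s \<and> s * ?f s \<le> t * ?f t" if "real_of_rat a' \<le> s" "s \<le> t" "0 < s" for s t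
    using 3(1)[of s t] 3(2) that tail by auto
  have low: "?f t \<le> ?f s \<and> s * ?f s \<le> t * ?f t" if "0 < s" "s \<le> t" "t \<le> real_of_rat a'" for s t
    using piece[OF that] L that by auto
  have a': "0 < real_of_rat a'" using ab by simp
  consider "t \<le> real_of_rat a'" | "real_of_rat a' \<le> s" | "s \<le> real_of_rat a'" "real_of_rat a' \<le> t"
    by linarith
  then show ?case
  proof cases
    case 3
    then show ?thesis
      using low[of s "real_of_rat a'"] IH[of "real_of_rat a'" t] \<open>0 < s\<close> a' by force
  qed (use low[of s t] IH[of s t] 3 in blast)+
qed auto

text \<open>On the constant part up to the first point the value is some \<open>b \<ge> 0\<close>;
  since \<open>s * f s\<close> is non-decreasing, the sign carries over to larger arguments.\<close>

lemma interpolate_nonneg: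
  assumes "admissible ps" "0 < s"
  shows "0 \<le> interpolate ps s"
proof -
  obtain a b qs where ps: "ps = (a, b) # qs" using assms(1) by (cases ps) auto
  define x where "x = min s (real_of_rat a)"
  have a: "0 < a" using assms(1) ps by (cases qs) auto
  then have x: "0 < x" "x \<le> s" using assms(2) unfolding x_def by auto
  have "interpolate ps x = real_of_rat b"
    unfolding ps by (rule interpolate_le_first) (simp add: x_def)
  then have "0 \<le> x * interpolate ps x"
    using admissible_last_nonneg assms(1) ps x by simp
  also have "\<dots> \<le> s * interpolate ps s" using interpolate_mono[OF assms(1) x] by blast
  finally show ?thesis using assms(2) by (simp add: zero_le_mult_iff)
qed

section \<open>Interpolation at powers of two\<close>

text \<open>The exponents run from \<open>q\<close> down to 1, so speeds increase. From one point to
  the next the speed doubles and the time drops by 1.\<close>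

fun knots :: "nat \<Rightarrow> (rat \<times> rat) list" where
  "knots 0 = []"
| "knots (Suc e) = (1 / 2 ^ Suc e, rat_of_nat (e + 2)) # knots e"

text \<open>Neighbours satisfy \<open>a' = 2 * a\<close> and \<open>b - b' = 1\<close>, so the slope
  condition says \<open>2 \<le> b'\<close>. As the smallest exponent is 1, the values
  \<open>e + 1\<close> meet it, with equality at the last pair.\<close>

lemma admissible_knots: "0 < q \<Longrightarrow> admissible (knots q)"
proof (induction q)
  case (Suc e)
  then show ?case by (cases e) (auto simp: field_simps)
qed simp

lemma interpolate_knots:
  "1 \<le> e \<Longrightarrow> e \<le> q \<Longrightarrow> interpolate (knots q) (1 / 2 ^ e) = real e + 1"
proof (induction q)
  case (Suc q)
  show ?case
  proof (cases "e = Suc q")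
    case True
    then show ?thesis
      by (simp add: interpolate_le_first of_rat_divide of_rat_power of_rat_mult of_rat_add)
  next
    case False
    then have e: "1 \<le> e" "e \<le> q" using Suc by auto
    then obtain q' where q: "q = Suc q'" by (cases q) auto
    have "(2::real) ^ e \<le> 2 ^ q" using e by simp
    then have "real_of_rat (1 / 2 ^ q) \<le> 1 / 2 ^ e"
      by (simp add: of_rat_divide of_rat_power frac_le)
    moreover have "(1::rat) / 2 ^ Suc q < 1 / 2 ^ q" by (simp add: field_simps)
    ultimately have "interpolate (knots (Suc q)) (1 / 2 ^ e) = interpolate (knots q) (1 / 2 ^ e)"
      unfolding q knots.simps by (intro interpolate_ge_second) auto
    then show ?thesis using Suc.IH e by simp
  qed
qed simp

lemma admissible_sorted: "admissible ps \<Longrightarrow>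
    sorted_wrt (<) (map fst ps) \<and> (\<forall>(a, b) \<in> set ps. 0 < a \<and> 0 \<le> b)"
proof (induction ps rule: admissible.induct)
  case (3 a b a' b' ps)
  then show ?case by force
qed auto

lemma admissible_function:
  assumes "admissible ps"
  defines "f \<equiv> \<lambda>s. if s = 0 then \<infinity> else ereal (interpolate ps s)"
  shows "processing_time_function f" "describes ps f"
proof -
  show "processing_time_function f"
    unfolding processing_time_function_def f_def
    using interpolate_mono[OF assms(1)] interpolate_nonneg[OF assms(1)] by auto
  show "describes ps f"
    unfolding describes_def f_def using admissible_sorted[OF assms(1)] assms(1) by auto
qed

section \<open>The transformed instance\<close>

text \<open>The final 1 makes it exceed the total overhead \<open>n * (m + 2)\<close> of a schedule
  built from an assignment.\<close>

definition scale :: "unrelated_inst \<Rightarrow> nat" where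
  "scale x = um_n x * (um_m x + 2) + 1"

text \<open>The summand \<open>um_m x\<close> absorbs the gain from using several machines. The
  final 1 keeps the exponent \<open>scale x * p + 1\<close>, which remains after that, in the range
  of \<open>knots\<close>.\<close>

definition exponent :: "unrelated_inst \<Rightarrow> nat \<Rightarrow> nat" where
  "exponent x p = scale x * p + um_m x + 1"

text \<open>The sum of all processing times stands in for their maximum: it is simpler to compute
  and still polynomial in the unary input.\<close>

definition transform :: "unrelated_inst \<Rightarrow> malleable_inst" where
  "transform x = \<lparr>ml_m = um_m x, ml_n = um_n x, ml_s = (\<lambda>i j. 1 / 2 ^ exponent x (um_p x i j)),
     ml_f = (\<lambda>_ s. if s = 0 then \<infinity> else
       ereal (interpolate (knots (exponent x (\<Sum>i<um_m x. \<Sum>j<um_n x. um_p x i j))) s))\<rparr>"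

lemma exponent_pos: "0 < exponent x p"
  by (simp add: exponent_def)

lemma ml_valid_transform: "ml_valid (transform x)"
  unfolding ml_valid_def transform_def
  by (simp add: admissible_function admissible_knots exponent_pos)

lemma p_le_sum:
  fixes p :: "nat \<Rightarrow> nat \<Rightarrow> nat"
  assumes "i < m" "j < n"
  shows "p i j \<le> (\<Sum>i<m. \<Sum>j<n. p i j)"
proof -
  have "p i j \<le> (\<Sum>j<n. p i j)" using assms by (intro member_le_sum) auto
  also have "\<dots> \<le> (\<Sum>i<m. \<Sum>j<n. p i j)"
    using assms member_le_sum[of i "{..<m}" "\<lambda>i. \<Sum>j<n. p i j"] by auto
  finally show ?thesis .
qed

lemma exponent_mono: "p \<le> p' \<Longrightarrow> exponent x p \<le> exponent x p'"
  by (simp add: exponent_def)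

lemma ml_time_singleton:
  assumes "i < um_m x" "j < um_n x"
  shows "ml_time (transform x) j {i} = ereal (real (scale x * um_p x i j + (um_m x + 2)))"
proof -
  let ?e = "exponent x (um_p x i j)"
  have "interpolate (knots (exponent x (\<Sum>i<um_m x. \<Sum>j<um_n x. um_p x i j))) (1 / 2 ^ ?e) = real ?e + 1"
    using exponent_pos by (intro interpolate_knots exponent_mono p_le_sum assms) (simp add: Suc_leI)
  then have "ml_time (transform x) j {i} = ereal (real ?e + 1)"
    by (simp add: ml_time_def ml_sigma_def transform_def of_rat_divide of_rat_power)
  then show ?thesis by (simp add: exponent_def)
qed

lemma ml_time_empty: "ml_time (transform x) j {} = \<infinity>"
  by (simp add: ml_time_def ml_sigma_def transform_def)

text \<open>The factor \<open>2 ^ m\<close> bounding the speedup over machine \<open>k\<close>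
  cancels against the summand \<open>m\<close> of the exponent. The remaining 2 makes durations
  positive even for processing time 0.\<close>

lemma ml_time_ge:
  assumes S: "S \<subseteq> {..<um_m x}" and k: "k \<in> S" and j: "j < um_n x"
    and min: "\<And>i. i \<in> S \<Longrightarrow> um_p x k j \<le> um_p x i j"
  shows "ereal (real (scale x * um_p x k j + 2)) \<le> ml_time (transform x) j S"
proof -
  let ?m = "um_m x" and ?e = "scale x * um_p x k j + 1"
  let ?q = "exponent x (\<Sum>i<um_m x. \<Sum>j<um_n x. um_p x i j)"
  have fin: "finite S" using S finite_subset by blast
  define \<sigma> where "\<sigma> = (\<Sum>i\<in>S. 1 / 2 ^ exponent x (um_p x i j) :: real)"
  have \<sigma>: "real_of_rat (ml_sigma (transform x) j S) = \<sigma>"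
    by (simp add: ml_sigma_def transform_def of_rat_sum of_rat_divide of_rat_power \<sigma>_def)
  have pos: "0 < \<sigma>" unfolding \<sigma>_def using k fin by (intro sum_pos) auto
  have "\<sigma> \<le> (\<Sum>i\<in>S. 1 / 2 ^ exponent x (um_p x k j))"
    unfolding \<sigma>_def using min by (intro sum_mono frac_le) (auto simp: exponent_mono)
  also have "\<dots> = card S / 2 ^ exponent x (um_p x k j)" by simp
  also have "\<dots> \<le> 2 ^ ?m / 2 ^ exponent x (um_p x k j)"
  proof (intro divide_right_mono)
    have "card S \<le> ?m" using card_mono[OF _ S] by simp
    then have "real (card S) \<le> real ?m" by simp
    also have "\<dots> \<le> 2 ^ ?m" using of_nat_less_two_power less_imp_le by blast
    finally show "real (card S) \<le> 2 ^ ?m" .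
  qed simp
  also have "\<dots> = 1 / 2 ^ ?e"
    by (simp add: exponent_def power_add)
  finally have le: "\<sigma> \<le> 1 / 2 ^ ?e" .
  have "?e \<le> exponent x (um_p x k j)" by (simp add: exponent_def)
  moreover have "exponent x (um_p x k j) \<le> ?q"
    using S k j by (intro exponent_mono p_le_sum) auto
  ultimately have "?e \<le> ?q" by (rule le_trans)
  then have "interpolate (knots ?q) (1 / 2 ^ ?e) = real ?e + 1"
    by (intro interpolate_knots) auto
  then have "real ?e + 1 \<le> interpolate (knots ?q) \<sigma>"
    using interpolate_mono[OF admissible_knots[OF exponent_pos] pos le] by metis
  then show ?thesis
    unfolding ml_time_def \<sigma> using pos by (simp add: transform_def)
qed

section \<open>Comparison of the two makespans\<close>

text \<open>Induction by removing the interval that starts last; its start is the bound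
  \<open>C\<close> for the others.\<close>

lemma sum_intervals_le:
  fixes \<tau> l :: "'a \<Rightarrow> real"
  assumes "finite A" "\<And>j. j \<in> A \<Longrightarrow> 0 \<le> \<tau> j" "\<And>j. j \<in> A \<Longrightarrow> 0 < l j"
    and "\<And>j. j \<in> A \<Longrightarrow> \<tau> j + l j \<le> C" "0 \<le> C"
    and "\<And>j k. j \<in> A \<Longrightarrow> k \<in> A \<Longrightarrow> j \<noteq> k \<Longrightarrow> \<tau> j + l j \<le> \<tau> k \<or> \<tau> k + l k \<le> \<tau> j"
  shows "(\<Sum>j\<in>A. l j) \<le> C"
  using assms
proof (induction A arbitrary: C rule: finite_psubset_induct)
  case (psubset A)
  show ?case
  proof (cases "A = {}")
    case True
    then show ?thesis using psubset by simp
  next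
    case False
    then have "Max (\<tau> ` A) \<in> \<tau> ` A" using psubset.hyps by simp
    then obtain k where k: "k \<in> A" "\<tau> k = Max (\<tau> ` A)" by auto
    then have k: "k \<in> A" "\<And>j. j \<in> A \<Longrightarrow> \<tau> j \<le> \<tau> k" using psubset.hyps by auto
    have "(\<Sum>j\<in>A - {k}. l j) \<le> \<tau> k"
    proof (rule psubset.IH)
      \<comment> \<open>The alternative that \<open>k\<close> ends before \<open>j\<close> starts
        contradicts the choice of \<open>k\<close>, because \<open>l k\<close> is positive.\<close>
      show "\<tau> j + l j \<le> \<tau> k" if "j \<in> A - {k}" for j
        using psubset.prems(5)[of j k] psubset.prems(2)[of k] k that by force
    qed (use psubset.prems k in auto)
    then show ?thesis
      using psubset.prems(3)[of k] k psubset.hyps by (simp add: sum.remove[of A k])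
  qed
qed

lemma transform_sel [simp]: "ml_m (transform x) = um_m x" "ml_n (transform x) = um_n x"
  by (simp_all add: transform_def)

lemma completion_le_makespan: "j < ml_n x \<Longrightarrow> ml_completion x y j \<le> ml_makespan x y"
  unfolding ml_makespan_def by (intro Max_ge) auto

lemma um_load_le_makespan:
  "i < um_m x \<Longrightarrow> (\<Sum>j | j < um_n x \<and> a j = i. um_p x i j) \<le> um_makespan x a"
  unfolding um_makespan_def by (intro Max_ge) auto

text \<open>All jobs that \<open>a\<close> assigns to machine \<open>i\<close> also use
  \<open>i\<close> in the schedule, so their intervals are disjoint, and \<open>ml_time_ge\<close>
  bounds their lengths from below.\<close>

lemma scaled_makespan_le:
  assumes feas: "ml_feasible (transform x) (S, \<tau>)"
    and C: "ml_makespan (transform x) (S, \<tau>) \<le> ereal C"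
    and a: "\<And>j. j < um_n x \<Longrightarrow> a j \<in> S j \<and> (\<forall>i\<in>S j. um_p x (a j) j \<le> um_p x i j)"
    and "0 < um_m x"
  shows "real (scale x * um_makespan x a) \<le> C"
proof -
  define l where "l j = real_of_ereal (ml_time (transform x) j (S j))" for j
  have S: "S j \<subseteq> {..<um_m x}" "0 \<le> \<tau> j" if "j < um_n x" for j
    using feas that unfolding ml_feasible_def by auto
  have compl: "ml_completion (transform x) (S, \<tau>) j \<le> ereal C" if "j < um_n x" for j
    using completion_le_makespan[of j "transform x"] C that order_trans by fastforce
  have ge: "ereal (real (scale x * um_p x (a j) j + 2)) \<le> ml_time (transform x) j (S j)"
    if "j < um_n x" for j
    using a[OF that] S[OF that] that by (intro ml_time_ge) auto
  \<comment> \<open>The makespan bound excludes \<open>\<infinity>\<close> and the lower bound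
    excludes \<open>-\<infinity>\<close>, so durations are real.\<close>
  have time: "ml_time (transform x) j (S j) = ereal (l j)" if "j < um_n x" for j
    using compl[OF that] ge[OF that] unfolding ml_completion_def l_def
    by (cases "ml_time (transform x) j (S j)") auto
  have l: "real (scale x * um_p x (a j) j + 2) \<le> l j" if "j < um_n x" for j
    using ge[OF that] time[OF that] by simp
  have end_le: "\<tau> j + l j \<le> C" if "j < um_n x" for j
    using compl[OF that] time[OF that] by (simp add: ml_completion_def)
  have "0 \<le> ml_makespan (transform x) (S, \<tau>)"
    unfolding ml_makespan_def by (intro Max_ge) auto
  then have "0 \<le> C" using C by (meson ereal_less_eq(5) order_trans)
  have load: "real (scale x * (\<Sum>j | j < um_n x \<and> a j = i. um_p x i j)) \<le> C" for i
  proof -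
    let ?A = "{j. j < um_n x \<and> a j = i}"
    have "real (scale x * (\<Sum>j\<in>?A. um_p x i j)) = (\<Sum>j\<in>?A. real (scale x * um_p x (a j) j))"
      by (simp add: sum_distrib_left)
    also have "\<dots> \<le> (\<Sum>j\<in>?A. l j)"
    proof (intro sum_mono)
      show "real (scale x * um_p x (a j) j) \<le> l j" if "j \<in> ?A" for j
        using l[of j] that by simp
    qed
    also have "\<dots> \<le> C"
    proof (rule sum_intervals_le[of _ \<tau>])
      fix j k assume jk: "j \<in> ?A" "k \<in> ?A" "j \<noteq> k"
      then have "i \<in> S j \<inter> S k" using a[of j] a[of k] by auto
      then have "ml_completion (transform x) (S, \<tau>) j \<le> ereal (\<tau> k)
        \<or> ml_completion (transform x) (S, \<tau>) k \<le> ereal (\<tau> j)"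
        using feas jk unfolding ml_feasible_def by fastforce
      then show "\<tau> j + l j \<le> \<tau> k \<or> \<tau> k + l k \<le> \<tau> j"
        using jk time by (simp add: ml_completion_def)
    next
      have "0 < real (scale x * um_p x (a j) j + 2)" for j by linarith
      then show "0 < l j" if "j \<in> ?A" for j
        using l[of j] that less_le_trans by blast
    qed (use S end_le \<open>0 \<le> C\<close> in auto)
    finally show ?thesis .
  qed
  have "um_makespan x a \<in> (\<lambda>i. \<Sum>j | j < um_n x \<and> a j = i. um_p x i j) ` {..<um_m x}"
    unfolding um_makespan_def using \<open>0 < um_m x\<close> by (intro Max_in) auto
  then show ?thesis using load by auto
qed

text \<open>Each machine runs its jobs in index order without idle time. A job costs
  \<open>m + 2\<close> beyond its scaled processing time, and at most \<open>n\<close> jobs share a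
  machine.\<close>

lemma schedule_of_assignment:
  assumes b: "um_feasible x b"
  obtains y where "ml_feasible (transform x) y"
    "ml_makespan (transform x) y \<le> ereal (real (scale x * um_makespan x b + um_n x * (um_m x + 2)))"
proof -
  let ?C = "scale x * um_makespan x b + um_n x * (um_m x + 2)"
  define w where "w j = scale x * um_p x (b j) j + (um_m x + 2)" for j
  define start where "start j = (\<Sum>k | k < j \<and> b k = b j. w k)" for j
  define y where "y = ((\<lambda>j. {b j}), (\<lambda>j. real (start j)))"
  have compl: "ml_completion (transform x) y j = ereal (real (start j + w j))" if "j < um_n x" for j
    using b that unfolding y_def ml_completion_def w_def
    by (simp add: ml_time_singleton um_feasible_def)
  have start: "start j + w j = (\<Sum>k | k \<le> j \<and> b k = b j. w k)" for j
  proof -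
    have "{k. k \<le> j \<and> b k = b j} = insert j {k. k < j \<and> b k = b j}" by auto
    then show ?thesis unfolding start_def by simp
  qed
  have before: "start j + w j \<le> start k" if "j < k" "b j = b k" for j k
    unfolding start start_def[of k] using that by (intro sum_mono2) auto
  have disjoint: "ml_completion (transform x) y j \<le> ereal (real (start k))
      \<or> ml_completion (transform x) y k \<le> ereal (real (start j))"
    if jk: "j < um_n x" "k < um_n x" "j \<noteq> k" "b j = b k" for j k
  proof -
    have "start j + w j \<le> start k \<or> start k + w k \<le> start j"
      using before[of j k] before[of k j] jk by (metis linorder_neqE_nat)
    then show ?thesis using compl jk by (simp flip: of_nat_add)
  qed
  have "ml_feasible (transform x) y"
    using disjoint b unfolding ml_feasible_def by (simp add: y_def um_feasible_def)
  moreover have "start j + w j \<le> ?C" if "j < um_n x" for j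
  proof -
    let ?A = "{k. k < um_n x \<and> b k = b j}"
    have "start j + w j \<le> (\<Sum>k\<in>?A. w k)"
      unfolding start using that by (intro sum_mono2) auto
    also have "\<dots> = scale x * (\<Sum>k\<in>?A. um_p x (b j) k) + card ?A * (um_m x + 2)"
      unfolding w_def by (simp add: sum.distrib sum_distrib_left del: add_2_eq_Suc')
    also have "\<dots> \<le> ?C"
    proof (intro add_mono mult_le_mono)
      show "(\<Sum>k\<in>?A. um_p x (b j) k) \<le> um_makespan x b"
        using b that by (intro um_load_le_makespan) (simp add: um_feasible_def)
      show "card ?A \<le> um_n x"
        using card_mono[of "{..<um_n x}" ?A] by auto
    qed auto
    finally show ?thesis .
  qed
  then have "ml_makespan (transform x) y \<le> ereal (real ?C)"
    unfolding ml_makespan_def using compl by (subst Max_le_iff) (auto simp flip: of_nat_add)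
  ultimately show ?thesis using that by blast
qed

text \<open>The overhead is less than \<open>scale x\<close>, one unit of the original makespan
  after scaling; as original makespans are integers, it cannot hide a better assignment.\<close>

lemma optimal_assignment:
  assumes opt: "optimal malleable_scheduling (transform x) (S, \<tau>)"
    and a: "\<And>j. j < um_n x \<Longrightarrow> a j \<in> S j \<and> (\<forall>i\<in>S j. um_p x (a j) j \<le> um_p x i j)"
    and m: "0 < um_m x"
  shows "optimal unrelated_scheduling x a"
proof -
  have feas: "ml_feasible (transform x) (S, \<tau>)"
    and opt: "\<And>y. ml_feasible (transform x) y \<Longrightarrow>
      ml_makespan (transform x) (S, \<tau>) \<le> ml_makespan (transform x) y"
    using opt unfolding optimal_def malleable_scheduling_def by auto
  have "um_feasible x a"
    using feas a unfolding um_feasible_def ml_feasible_def by auto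
  moreover have "um_makespan x a \<le> um_makespan x b" if b: "um_feasible x b" for b
  proof -
    obtain y where y: "ml_feasible (transform x) y"
      "ml_makespan (transform x) y \<le> ereal (real (scale x * um_makespan x b + um_n x * (um_m x + 2)))"
      using schedule_of_assignment[OF b] by blast
    have "real (scale x * um_makespan x a) \<le> real (scale x * um_makespan x b + um_n x * (um_m x + 2))"
      using scaled_makespan_le[OF feas order_trans[OF opt[OF y(1)] y(2)] a m] .
    also have "\<dots> < real (scale x * (um_makespan x b + 1))"
      by (simp add: scale_def algebra_simps)
    finally have "scale x * um_makespan x a < scale x * (um_makespan x b + 1)"
      by (simp only: of_nat_less_iff)
    then have "um_makespan x a < um_makespan x b + 1" using mult_less_cancel1 by blast
    then show ?thesis by simp
  qed
  ultimately show ?thesis unfolding optimal_def unrelated_scheduling_def by simp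
qed

lemma optimal_nonempty:
  assumes opt: "optimal malleable_scheduling (transform x) (S, \<tau>)"
    and m: "0 < um_m x" and j: "j < um_n x"
  shows "S j \<noteq> {}"
proof
  assume "S j = {}"
  then have "ml_completion (transform x) (S, \<tau>) j = \<infinity>"
    by (simp add: ml_completion_def ml_time_empty)
  then have inf: "ml_makespan (transform x) (S, \<tau>) = \<infinity>"
    using completion_le_makespan[of j "transform x" "(S, \<tau>)"] j by simp
  \<comment> \<open>Placing all jobs on machine 0 gives a finite makespan, which contradicts the
    optimality of an infinite one.\<close>
  obtain y C where "ml_feasible (transform x) y" "ml_makespan (transform x) y \<le> ereal C"
    using schedule_of_assignment[of x "\<lambda>_. 0"] m by (metis um_feasible_def)
  then show False
    using opt inf unfolding optimal_def malleable_scheduling_def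
    by (cases y) (auto dest!: spec[of _ y])
qed

section \<open>The algorithms\<close>

definition inst_tree :: "unrelated_inst \<Rightarrow> tree" where
  "inst_tree x = list_tree [unary (um_m x), unary (um_n x), list_tree (map (\<lambda>i. list_tree
    (map (\<lambda>j. unary (um_p x i j)) [0..<um_n x])) [0..<um_m x])]"

abbreviation (input) "machines_tree d \<equiv> hd_tree d"
abbreviation (input) "jobs_tree d \<equiv> hd_tree (tl_tree d)"
abbreviation (input) "matrix_tree d \<equiv> hd_tree (tl_tree (tl_tree d))"

section \<open>Computing the transformed instance\<close>

definition exponent_tree :: "tree \<Rightarrow> tree \<Rightarrow> tree" where
  "exponent_tree d p =
     uadd (umul (Node Leaf (umul (jobs_tree d) (Node Leaf (Node Leaf (machines_tree d))))) p)
       (Node Leaf (machines_tree d))"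

definition one_tree :: tree where "one_tree = Node btrue Leaf"

text \<open>Here \<open>uadd\<close> acts as a shift: \<open>e\<close> zero bits below the bit 1
  form the binary code of \<open>2 ^ e\<close>, whose size is linear in \<open>e\<close>.\<close>

definition inverse_power_tree :: "tree \<Rightarrow> tree" where
  "inverse_power_tree e = Node one_tree (uadd e one_tree)"

definition knot_tree :: "tree \<Rightarrow> tree" where
  "knot_tree e = Node (inverse_power_tree e) (Node (to_binary (Node Leaf e)) one_tree)"

text \<open>The suffixes of a unary number are the smaller unary numbers, so mapping
  \<open>knot_tree\<close> over the largest exponent lists all knots. Mapping a constant over
  \<open>jobs_tree d\<close> makes one copy for each job.\<close>

definition transform_tree :: "tree \<Rightarrow> tree" where
  "transform_tree d =
     Node (to_binary (machines_tree d)) (Node (to_binary (jobs_tree d))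
     (Node (tmap (\<lambda>r. tmap (\<lambda>p. inverse_power_tree (exponent_tree d (hd_tree p))) (hd_tree r))
       (matrix_tree d))
     (Node (tmap (\<lambda>_. tmap knot_tree (exponent_tree d (tsum (tsum (\<lambda>p. p)) (matrix_tree d))))
       (jobs_tree d)) Leaf)))"

lemmas ptime_arith_intros =
  ptime_intros ptime_uadd ptime_umul ptime_to_binary ptime_tdrop ptime_tsum ptime_tmap

lemma ptime_transform_tree: "ptime transform_tree"
  unfolding transform_tree_def knot_tree_def inverse_power_tree_def exponent_tree_def
    one_tree_def btrue_def
  by (intro ptime_arith_intros)

lemma one_tree [simp]: "one_tree = binary 1"
  by (simp add: one_tree_def btrue_def bool_tree_def binary.simps[of "Suc 0"])

lemma uadd_one_tree [simp]: "uadd (unary e) (binary (Suc 0)) = binary (2 ^ e)"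
proof (induction e)
  case (Suc e)
  then show ?case by (simp add: binary.simps[of "2 * 2 ^ e"] bool_tree_def)
qed simp

lemma inverse_power_tree_unary [simp]:
  "inverse_power_tree (unary e) = rat_tree binary (1 / 2 ^ e)"
proof -
  have "quotient_of (1 / 2 ^ e) = (1, 2 ^ e)"
    using quotient_of_Fract[of 1 "2 ^ e"]
    by (simp add: Fract_of_int_quotient Rat.normalize_def Let_def)
  then show ?thesis by (simp add: inverse_power_tree_def rat_tree_def nat_power_eq)
qed

lemma knot_tree_unary [simp]:
  "knot_tree (unary e) = Node (rat_tree binary (1 / 2 ^ e)) (rat_tree binary (rat_of_nat (e + 1)))"
proof -
  have "quotient_of (rat_of_nat (e + 1)) = (int (e + 1), 1)"
    unfolding of_nat_rat by (simp add: quotient_of_Fract Rat.normalize_def)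
  then have "rat_tree binary (rat_of_nat (e + 1)) = Node (binary (e + 1)) (binary 1)"
    by (simp only: rat_tree_def prod.case nat_int) simp
  moreover have "to_binary (Node Leaf (unary e)) = binary (e + 1)"
    using to_binary_unary[of "Suc e"] by simp
  ultimately show ?thesis by (simp add: knot_tree_def)
qed

lemma tmap_knot_tree: "tmap knot_tree (unary q) =
    list_tree (map (\<lambda>(a, b). Node (rat_tree binary a) (rat_tree binary b)) (knots q))"
proof (induction q)
  case (Suc q)
  then show ?case using knot_tree_unary[of "Suc q"] by simp
qed simp

lemma exponent_tree_inst [simp]:
  "exponent_tree (inst_tree x) (unary p) = unary (exponent x p)"
  unfolding exponent_tree_def inst_tree_def
  \<comment> \<open>Read backwards, the rule turns \<open>Node Leaf\<close> into a successor, which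
    restores the form \<open>unary _\<close> that the arithmetic rules match.\<close>
  by (simp flip: unary_simps(2)) (simp add: exponent_def scale_def flip: unary_simps(2))

lemma transform_tree_inst:
  "ml_inst_code binary (transform x) (transform_tree (inst_tree x))"
proof -
  let ?q = "exponent x (\<Sum>i<um_m x. \<Sum>j<um_n x. um_p x i j)"
  let ?mat = "list_tree (map (\<lambda>i. list_tree (map (\<lambda>j. unary (um_p x i j)) [0..<um_n x]))
    [0..<um_m x])"
  have sel: "machines_tree (inst_tree x) = unary (um_m x)" "jobs_tree (inst_tree x) = unary (um_n x)"
    "matrix_tree (inst_tree x) = ?mat"
    by (simp_all add: inst_tree_def)
  have "tsum (tsum (\<lambda>p. p)) ?mat = unary (\<Sum>i\<leftarrow>[0..<um_m x]. \<Sum>j\<leftarrow>[0..<um_n x]. um_p x i j)"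
    by (intro tsum_list) simp
  then have sum: "tsum (tsum (\<lambda>p. p)) ?mat = unary (\<Sum>i<um_m x. \<Sum>j<um_n x. um_p x i j)"
    by (simp add: interv_sum_list_conv_sum_set_nat atLeast0LessThan)
  have speeds: "tmap (\<lambda>r. tmap (\<lambda>p. inverse_power_tree (exponent_tree (inst_tree x) (hd_tree p)))
      (hd_tree r)) ?mat =
    list_tree (map (\<lambda>i. list_tree (map (\<lambda>j. rat_tree binary (ml_s (transform x) i j))
      [0..<um_n x])) [0..<um_m x])"
    by (simp add: tmap_hd[where g = "\<lambda>r. tmap _ r"]
        tmap_hd[where g = "\<lambda>p. inverse_power_tree (exponent_tree (inst_tree x) p)"] transform_def)
  have funs: "tmap (\<lambda>_. t) (unary n) = list_tree (map (\<lambda>j. t) [0..<n])" for t n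
    by (simp add: unary_def tmap_suffixes)
  have "describes (knots ?q) (ml_f (transform x) j)" for j
    using admissible_function(2)[OF admissible_knots[OF exponent_pos]] by (simp add: transform_def)
  then show ?thesis
    unfolding ml_inst_code_def transform_tree_def sel sum exponent_tree_inst tmap_knot_tree funs speeds
    by (intro exI[of _ "\<lambda>_. knots ?q"]) simp
qed

section \<open>Recovering an assignment\<close>

text \<open>\<open>u\<close> is the rest of the solution from job \<open>j\<close> on and
  \<open>v\<close> the rest of its incidence vector from machine \<open>i\<close> on. Dropping their
  lengths from \<open>n\<close> and \<open>m\<close> recovers \<open>j\<close> and \<open>i\<close>;
  the pair consists of \<open>i\<close> and its processing time for \<open>j\<close>.\<close>

definition candidate :: "tree \<Rightarrow> tree \<Rightarrow> tree \<Rightarrow> tree" where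
  "candidate d u v = Node (tdrop v (machines_tree d))
     (hd_tree (tdrop (tdrop u (jobs_tree d))
       (hd_tree (tdrop (tdrop v (machines_tree d)) (matrix_tree d)))))"

text \<open>\<open>Leaf\<close> means that no machine has been found yet. The inner test holds iff
  the time of \<open>c\<close> is at most that of \<open>a\<close>.\<close>

definition improve :: "tree \<Rightarrow> tree \<Rightarrow> tree" where
  "improve c a = (if a = Leaf then c else if tdrop (tl_tree a) (tl_tree c) = Leaf then c else a)"

definition best :: "tree \<Rightarrow> tree \<Rightarrow> tree \<Rightarrow> tree" where
  "best d u = trec (\<lambda>v a. if hd_tree v = Leaf then a else improve (candidate d u v) a) Leaf"

definition assignment_tree :: "tree \<Rightarrow> tree" where
  "assignment_tree w = tmap (\<lambda>u. hd_tree (best (hd_tree w) u (hd_tree (hd_tree u)))) (tl_tree w)"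

text \<open>\<open>improve\<close> returns one of its two arguments, so the size of a candidate
  bounds the growth of each step.\<close>

lemma ptime_best:
  assumes "ptime d" "ptime u" "ptime v"
  shows "ptime (\<lambda>w. best (d w) (u w) (v w))"
  unfolding best_def
proof (rule ptime_rec[where f = "\<lambda>w v. candidate (d w) (u w) v"
      and h = "\<lambda>w v a. if hd_tree v = Leaf then a else improve (candidate (d w) (u w) v) a"])
  show "ptime (\<lambda>w. candidate (d (hd_tree w)) (u (hd_tree w)) (tl_tree w))"
    unfolding candidate_def
    by (intro ptime_arith_intros ptime_comp[OF assms(1)] ptime_comp[OF assms(2)])
  show "ptime (\<lambda>w. if hd_tree (hd_tree (tl_tree w)) = Leaf then tl_tree (tl_tree w)
      else improve (candidate (d (hd_tree w)) (u (hd_tree w)) (hd_tree (tl_tree w)))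
        (tl_tree (tl_tree w)))"
    unfolding candidate_def improve_def
    by (intro ptime_arith_intros ptime_comp[OF assms(1)] ptime_comp[OF assms(2)])
qed (use assms in \<open>auto simp: improve_def intro: ptime_Leaf\<close>)

lemma ptime_assignment_tree: "ptime assignment_tree"
  unfolding assignment_tree_def
  by (intro ptime_arith_intros ptime_best)

lemma tdrop_unary [simp]: "tdrop (unary a) (unary b) = unary (b - a)"
  unfolding unary_def by (simp add: tdrop_list_tree)

lemma tdrop_list_unary: "tdrop (list_tree ts) (unary n) = unary (n - length ts)"
  unfolding unary_def by (simp add: tdrop_list_tree)

lemma hd_tdrop_unary: "i < length ts \<Longrightarrow> hd_tree (tdrop (unary i) (list_tree ts)) = ts ! i"
  unfolding unary_def by (simp add: tdrop_list_tree hd_list_tree hd_drop_conv_nth)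

lemma unary_eq_Leaf [simp]: "unary n = Leaf \<longleftrightarrow> n = 0"
  by (cases n) auto

lemma candidate_inst:
  assumes "length us = um_n x - j" "j < um_n x" "length vs = um_m x - i" "i < um_m x"
  shows "candidate (inst_tree x) (list_tree us) (list_tree vs) = Node (unary i) (unary (um_p x i j))"
  using assms
  by (simp add: candidate_def inst_tree_def tdrop_list_unary hd_tdrop_unary)

text \<open>Downward induction on \<open>k\<close> follows the recursion, which starts at the end of
  the incidence vector; the first disjunct covers the time before any machine of \<open>S\<close> is
  met.\<close>

lemma best_inst:
  fixes S :: "nat set"
  assumes u: "length us = um_n x - j" "j < um_n x" and k: "k \<le> um_m x"
  defines "r \<equiv> best (inst_tree x) (list_tree us)
    (list_tree (map (\<lambda>i. bool_tree (i \<in> S)) [k..<um_m x]))"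
  shows "r = Leaf \<and> S \<inter> {k..<um_m x} = {} \<or>
    (\<exists>i \<in> S \<inter> {k..<um_m x}. r = Node (unary i) (unary (um_p x i j)) \<and>
      (\<forall>i' \<in> S \<inter> {k..<um_m x}. um_p x i j \<le> um_p x i' j))"
  using k unfolding r_def
proof (induction k rule: inc_induct)
  case base
  then show ?case by (simp add: best_def)
next
  case (step k)
  let ?l = "\<lambda>k. list_tree (map (\<lambda>i. bool_tree (i \<in> S)) [k..<um_m x])"
  let ?r = "best (inst_tree x) (list_tree us) (?l (Suc k))"
  have k: "{k..<um_m x} = insert k {Suc k..<um_m x}" using step.hyps by auto
  have "best (inst_tree x) (list_tree us) (?l k) =
    (if k \<in> S then improve (candidate (inst_tree x) (list_tree us) (?l k)) ?r else ?r)"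
    using step.hyps by (simp add: best_def upt_conv_Cons bool_tree_def)
  moreover have "candidate (inst_tree x) (list_tree us) (?l k) = Node (unary k) (unary (um_p x k j))"
    using step.hyps u by (intro candidate_inst) auto
  ultimately have rec: "best (inst_tree x) (list_tree us) (?l k) =
    (if k \<in> S then improve (Node (unary k) (unary (um_p x k j))) ?r else ?r)"
    by simp
  show ?case
  proof (cases "k \<in> S")
    case False
    then show ?thesis using step.IH rec k by auto
  next
    case True
    from step.IH show ?thesis
    proof (elim disjE bexE conjE)
      assume "?r = Leaf" "S \<inter> {Suc k..<um_m x} = {}"
      then show ?thesis using rec k True by (auto simp: improve_def)
    next
      fix i assume i: "i \<in> S \<inter> {Suc k..<um_m x}" "?r = Node (unary i) (unary (um_p x i j))"
        "\<forall>i' \<in> S \<inter> {Suc k..<um_m x}. um_p x i j \<le> um_p x i' j"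
      show ?thesis
      proof (cases "um_p x k j \<le> um_p x i j")
        case le: True
        then have "best (inst_tree x) (list_tree us) (?l k) = Node (unary k) (unary (um_p x k j))"
          using rec True i(2) by (simp add: improve_def)
        then show ?thesis using True k i(3) le by (auto intro!: bexI[of _ k] intro: order_trans)
      next
        case gt: False
        then have "best (inst_tree x) (list_tree us) (?l k) = Node (unary i) (unary (um_p x i j))"
          using rec True i(2) by (simp add: improve_def)
        then show ?thesis using k i gt by (auto intro!: bexI[of _ i])
      qed
    qed
  qed
qed

text \<open>Optimality makes every \<open>S j\<close> non-empty, so \<open>best_inst\<close> at
  \<open>k = 0\<close> delivers a machine of least processing time, as
  \<open>optimal_assignment\<close> demands.\<close>

lemma assignment_tree_inst:
  assumes x: "0 < um_m x" and opt: "optimal malleable_scheduling (transform x) y"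
    and e: "ml_sol_code binary (transform x) y e"
  shows "\<exists>a. um_sol_code unary x a (assignment_tree (Node (inst_tree x) e)) \<and>
    optimal unrelated_scheduling x a"
proof -
  obtain S \<tau> where y: "y = (S, \<tau>)" by (cases y)
  obtain r where e: "e = list_tree (map (\<lambda>j. Node
      (list_tree (map (\<lambda>i. bool_tree (i \<in> S j)) [0..<um_m x])) (rat_tree binary (r j))) [0..<um_n x])"
    (is "e = list_tree ?ts")
    using e unfolding ml_sol_code_def y by auto
  let ?res = "\<lambda>j. hd_tree (best (inst_tree x) (list_tree (drop j ?ts))
    (hd_tree (hd_tree (list_tree (drop j ?ts)))))"
  have tree: "assignment_tree (Node (inst_tree x) e) = list_tree (map ?res [0..<um_n x])"
    unfolding assignment_tree_def e hd_tree.simps tl_tree.simps tmap_suffixes by simp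
  have S: "S j \<subseteq> {..<um_m x}" if "j < um_n x" for j
    using opt that unfolding y optimal_def malleable_scheduling_def ml_feasible_def by auto
  have "\<exists>i. ?res j = unary i \<and> i \<in> S j \<and> (\<forall>i' \<in> S j. um_p x i j \<le> um_p x i' j)"
    if j: "j < um_n x" for j
  proof -
    have "S j \<inter> {0..<um_m x} = S j" using S[OF j] by auto
    moreover have "S j \<noteq> {}" using optimal_nonempty opt x j unfolding y by blast
    moreover have "hd_tree (hd_tree (list_tree (drop j ?ts))) =
        list_tree (map (\<lambda>i. bool_tree (i \<in> S j)) [0..<um_m x])"
      using j by (simp add: hd_list_tree hd_drop_conv_nth)
    moreover have "length (drop j ?ts) = um_n x - j" by simp
    ultimately obtain i where "i \<in> S j" "\<forall>i' \<in> S j. um_p x i j \<le> um_p x i' j"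
      "?res j = hd_tree (Node (unary i) (unary (um_p x i j)))"
      using best_inst[of "drop j ?ts" x j 0 "S j", OF _ j le0] by metis
    then show ?thesis unfolding hd_tree.simps by blast
  qed
  then have "\<forall>j. \<exists>i. j < um_n x \<longrightarrow>
      ?res j = unary i \<and> i \<in> S j \<and> (\<forall>i' \<in> S j. um_p x i j \<le> um_p x i' j)"
    by blast
  then obtain a where "\<forall>j. j < um_n x \<longrightarrow>
      ?res j = unary (a j) \<and> a j \<in> S j \<and> (\<forall>i' \<in> S j. um_p x (a j) j \<le> um_p x i' j)"
    unfolding choice_iff by blast
  then have a: "\<And>j. j < um_n x \<Longrightarrow> ?res j = unary (a j)"
    "\<And>j. j < um_n x \<Longrightarrow> a j \<in> S j \<and> (\<forall>i \<in> S j. um_p x (a j) j \<le> um_p x i j)"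
    by blast+
  have "um_sol_code unary x a (assignment_tree (Node (inst_tree x) e))"
    unfolding um_sol_code_def tree
    by (rule arg_cong[of _ _ list_tree], rule map_cong[OF refl], rule a(1)) simp
  moreover have "optimal unrelated_scheduling x a"
    using optimal_assignment opt a(2) x unfolding y by blast
  ultimately show ?thesis by blast
qed

theorem theorem5p1:
  "\<exists>F. pseudopoly_transformation unrelated_scheduling malleable_scheduling F"
proof
  \<comment> \<open>An instance has exactly one unary code, so both algorithms need to be considered
    on \<open>inst_tree x\<close> only.\<close>
  have code: "inst_code unrelated_scheduling unary x d \<longleftrightarrow> d = inst_tree x" for x d
    by (simp add: unrelated_scheduling_def um_inst_code_def inst_tree_def)
  obtain c q where c: "\<And>d. \<exists>t. computes_in c d (transform_tree d) t \<and> t \<le> poly q (size d)"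
    using ptime_computes_in[OF ptime_transform_tree] by metis
  obtain c' q' where c': "\<And>d. \<exists>t. computes_in c' d (assignment_tree d) t \<and> t \<le> poly q' (size d)"
    using ptime_computes_in[OF ptime_assignment_tree] by metis
  show "pseudopoly_transformation unrelated_scheduling malleable_scheduling transform"
    unfolding pseudopoly_transformation_def code
  proof (intro conjI ballI)
    show "transform x \<in> insts malleable_scheduling" for x
      using ml_valid_transform by (simp add: malleable_scheduling_def)
    show "\<exists>c (q :: nat poly). \<forall>x\<in>insts unrelated_scheduling. \<forall>d. d = inst_tree x \<longrightarrow>
        (\<exists>d' t. computes_in c d d' t \<and> t \<le> poly q (size d) \<and>
          inst_code malleable_scheduling binary (transform x) d')"
      using c transform_tree_inst by (fastforce simp: malleable_scheduling_def)
    have "\<exists>z d' t. computes_in c' (Node d e) d' t \<and> t \<le> poly q' (size (Node d e)) \<and>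
        sol_code unrelated_scheduling unary x z d' \<and> optimal unrelated_scheduling x z"
      if x: "x \<in> insts unrelated_scheduling" "d = inst_tree x"
        "optimal malleable_scheduling (transform x) y"
        "sol_code malleable_scheduling binary (transform x) y e" for x y d e
    proof -
      have "0 < um_m x" "ml_sol_code binary (transform x) y e"
        using x by (simp_all add: unrelated_scheduling_def malleable_scheduling_def)
      then obtain a where "um_sol_code unary x a (assignment_tree (Node d e))"
        "optimal unrelated_scheduling x a"
        using assignment_tree_inst x(2,3) by metis
      moreover have "sol_code unrelated_scheduling = um_sol_code"
        by (simp add: unrelated_scheduling_def)
      ultimately show ?thesis using c'[of "Node d e"] by metis
    qed
    then show "\<exists>c (q :: nat poly). \<forall>x\<in>insts unrelated_scheduling. \<forall>y d e. d = inst_tree x \<longrightarrow>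
        optimal malleable_scheduling (transform x) y \<longrightarrow>
        sol_code malleable_scheduling binary (transform x) y e \<longrightarrow>
        (\<exists>z d' t. computes_in c (Node d e) d' t \<and> t \<le> poly q (size (Node d e)) \<and>
          sol_code unrelated_scheduling unary x z d' \<and> optimal unrelated_scheduling x z)"
      by (intro exI[of _ c'] exI[of _ q']) simp
  qed
qed

end
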